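(* Let $r\ge 2$ be an integer and let $q$ be a complex number with $0<|q|<1$. Let $\mathbf a=(a_1,\dots,a_r)\in\mathbb C^r$ satisfy $a_i-a_j\notin\mathbb Z$ for $1\le i<j\le r$, let $\mathbf b=(b_1,\dots,b_r)\in\mathbb C^r$ be arbitrary, and let $\mathbf m=(m_1,\dots,m_r)\in\mathbb Z^r$, $\mathbf n=(n_1,\dots,n_r)\in\mathbb Z^r$, $t\in\mathbb Z$. Put $$M=\sum_{i=1}^r m_i,\quad N=\sum_{i=1}^r n_i,\quad m_{\min}=\min_{1\le i\le r}m_i,\quad n_{\max}=\max_{1\le i\le r}n_i,$$ $$p=\max\{-1,\,M-N-r-t+1\},\qquad W=q^{t+r-1}\prod_{i=1}^r q^{a_i-b_i},$$ and assume $|W|<1$. For integers $j\ge -n_{\max}$ let $$\alpha_j=\sum_{i=1}^r\frac{q^{a_i(1-t)}\prod_{l=1}^r(q^{1-b_l+a_i};q)_{m_l+j}}{(q;q)_{j+n_i}\prod_{l\ne i}(q^{a_i-a_l};q)_{n_l+j+1}}\;{}_{2r}\phi_{2r-1}\left(\begin{array}{c}q^{-j-n_i},\ (q^{b_l-a_i})_{1\le l\le r},\ (q^{a_l-a_i-n_l-j})_{l\ne i}\\ (q^{b_l-a_i-m_l-j})_{1\le l\le r},\ (q^{1-a_i+a_l})_{l\ne i}\end{array}\Big|\ q^{N-M+r-1+t}\right),$$ where every term with $j+n_i<0$ is taken to be $0$, and for integers $k\ge -n_{\max}$ let $$\beta_k=\sum_{j=\max(-n_{\max},\,k-p-(t)_+-1)}^{k}(-1)^{k-j}\,\alpha_j\sum_{\substack{g+h=k-j\\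 g,h\ge 0}}\begin{bmatrix}p+1\\ h\end{bmatrix}_q\begin{bmatrix}(t)_+\\ g\end{bmatrix}_q q^{[h(h-1)+g(g-1)]/2}\,W^h .$$ Then $$\sum_{i=1}^r q^{a_i(1-t)}\frac{\prod_{l=1}^r(q^{1-b_l+a_i};q)_\infty}{\prod_{l\ne i}(q^{a_i-a_l};q)_\infty}\;{}_r\phi_{r-1}\left(\begin{array}{c}(q^{b_l-a_i})_{1\le l\le r}\\ (q^{1+a_l-a_i})_{l\ne i}\end{array}\Big|\ W\right)=\frac{(q^t;q)_\infty}{(W;q)_{p+1}}\sum_{k=-n_{\max}}^{p+(t)_+-m_{\min}}\beta_k .$$ (Since $(q^t;q)_\infty=0$ for $t\le0$, the right-hand side vanishes for such $t$.)
   Context: A logarithm of $q$ is fixed and $q^x=\exp(x\log q)$ for $x\in\mathbb C$. For $n\ge 1$ the $q$-shifted factorial is $(a;q)_0=1$, $(a;q)_n=\prod_{k=0}^{n-1}(1-aq^k)$, $(a;q)_{-n}=\prod_{k=1}^{n}\frac{1}{1-aq^{-k}}$, and $(a;q)_\infty=\lim_{n\to\infty}(a;q)_n$. In particular $1/(q;q)_{-n}=0$ for $n\ge1$. The basic hypergeometric function (base $q$ suppressed) is $${}_r\phi_{s}\left(\begin{array}{c}c_1,\dots,c_r\\ d_1,\dots,d_s\end{array}\Big|\ z\right)=\sum_{n=0}^\infty\frac{(c_1;q)_n\cdots(c_r;q)_n}{(d_1;q)_n\cdots(d_s;q)_n(q;q)_n}\left[(-1)^nq^{n(n-1)/2}\right]^{1+s-r}z^n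 ,\qquad r\le s+1;$$ for $r=s+1$ the series converges for $|z|<1$, and it terminates (so is defined for all $z$) if some upper parameter is $q^{-K}$ with $K\in\{0,1,2,\dots\}$. $\begin{bmatrix}n\\ j\end{bmatrix}_q=\frac{(q;q)_n}{(q;q)_j(q;q)_{n-j}}$ is the $q$-binomial coefficient (zero for $j>n$ or $j<0$), and $(x)_+=\max(0,x)$. Empty sums are $0$ and empty products are $1$. "$l\neq i$" means $1\le l\le r$, $l\ne i$. The identity is understood for parameter values for which all expressions occurring in it are defined (no vanishing denominators). *)

theory Defs
  imports "HOL-Analysis.Analysis"
begin

(* L is the fixed logarithm of q, so that qpow L x is q^x. *)
definition qpow :: "complex \<Rightarrow> complex \<Rightarrow> complex" where
  "qpow L x = exp (x * L)"

definition qpoch :: "complex \<Rightarrow> complex \<Rightarrow> int \<Rightarrow> complex" where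
  "qpoch a q n =
     (if n \<ge> 0 then (\<Prod>k<nat n. 1 - a * q ^ k)
      else (\<Prod>k=1..nat (- n). 1 / (1 - a * q powi (- int k))))"

(* For n < 0 the symbol (a;q)_n itself has denominators; this says that none of them vanishes. *)
definition qpoch_defined :: "complex \<Rightarrow> complex \<Rightarrow> int \<Rightarrow> bool" where
  "qpoch_defined a q n \<longleftrightarrow> (\<forall>k\<in>{1..nat (- n)}. 1 - a * q powi (- int k) \<noteq> 0)"

definition qpoch_inf :: "complex \<Rightarrow> complex \<Rightarrow> complex" where
  "qpoch_inf a q = lim (\<lambda>n. qpoch a q (int n))"

(* Intended for length cs \<le> length ds + 1.  If some upper parameter is q^(-K), every term with
   n > K is 0, also where a lower parameter makes its denominator vanish (x / 0 = 0). *)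
definition qhyp :: "complex \<Rightarrow> complex list \<Rightarrow> complex list \<Rightarrow> complex \<Rightarrow> complex" where
  "qhyp q cs ds z =
     (\<Sum>n. (\<Prod>c\<leftarrow>cs. qpoch c q (int n)) / ((\<Prod>d\<leftarrow>ds. qpoch d q (int n)) * qpoch q q (int n))
          * ((-1) ^ n * q ^ (n * (n - 1) div 2)) ^ (1 + length ds - length cs) * z ^ n)"

definition qbinom :: "complex \<Rightarrow> int \<Rightarrow> int \<Rightarrow> complex" where
  "qbinom q n j =
     (if 0 \<le> j \<and> j \<le> n then qpoch q q n / (qpoch q q j * qpoch q q (n - j)) else 0)"

definition p_ind :: "nat \<Rightarrow> (nat \<Rightarrow> int) \<Rightarrow> (nat \<Rightarrow> int) \<Rightarrow> int \<Rightarrow> int" where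
  "p_ind r m n t = max (-1) ((\<Sum>i=1..r. m i) - (\<Sum>i=1..r. n i) - int r - t + 1)"

definition min_ind :: "nat \<Rightarrow> (nat \<Rightarrow> int) \<Rightarrow> int" where
  "min_ind r m = Min (m ` {1..r})"

definition max_ind :: "nat \<Rightarrow> (nat \<Rightarrow> int) \<Rightarrow> int" where
  "max_ind r n = Max (n ` {1..r})"

definition pos_part :: "int \<Rightarrow> int" where
  "pos_part x = max 0 x"

definition W_arg ::
  "complex \<Rightarrow> complex \<Rightarrow> nat \<Rightarrow> (nat \<Rightarrow> complex) \<Rightarrow> (nat \<Rightarrow> complex) \<Rightarrow> int \<Rightarrow> complex" where
  "W_arg q L r a b t = q powi (t + int r - 1) * (\<Prod>i=1..r. qpow L (a i - b i))"

abbreviation idx :: "nat \<Rightarrow> nat list" where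
  "idx r \<equiv> [1..<Suc r]"

abbreviation idx_except :: "nat \<Rightarrow> nat \<Rightarrow> nat list" where
  "idx_except r i \<equiv> filter (\<lambda>l. l \<noteq> i) (idx r)"

definition alpha ::
  "complex \<Rightarrow> complex \<Rightarrow> nat \<Rightarrow> (nat \<Rightarrow> complex) \<Rightarrow> (nat \<Rightarrow> complex) \<Rightarrow> (nat \<Rightarrow> int) \<Rightarrow> (nat \<Rightarrow> int)
     \<Rightarrow> int \<Rightarrow> int \<Rightarrow> complex" where
  "alpha q L r a b m n t j =
     (\<Sum>i=1..r.
        if j + n i < 0 then 0
        else qpow L (a i * (1 - of_int t))
             * (\<Prod>l=1..r. qpoch (qpow L (1 - b l + a i)) q (m l + j))
             / (qpoch q q (j + n i)
                * (\<Prod>l\<in>{1..r} - {i}. qpoch (qpow L (a i - a l)) q (n l + j + 1)))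
             * qhyp q
                 ([q powi (- j - n i)]
                  @ map (\<lambda>l. qpow L (b l - a i)) (idx r)
                  @ map (\<lambda>l. qpow L (a l - a i - of_int (n l) - of_int j)) (idx_except r i))
                 (map (\<lambda>l. qpow L (b l - a i - of_int (m l) - of_int j)) (idx r)
                  @ map (\<lambda>l. qpow L (1 - a i + a l)) (idx_except r i))
                 (q powi ((\<Sum>l=1..r. n l) - (\<Sum>l=1..r. m l) + int r - 1 + t)))"

definition beta ::
  "complex \<Rightarrow> complex \<Rightarrow> nat \<Rightarrow> (nat \<Rightarrow> complex) \<Rightarrow> (nat \<Rightarrow> complex) \<Rightarrow> (nat \<Rightarrow> int) \<Rightarrow> (nat \<Rightarrow> int)
     \<Rightarrow> int \<Rightarrow> int \<Rightarrow> complex" where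
  "beta q L r a b m n t k =
     (\<Sum>j\<in>{max (- max_ind r n) (k - p_ind r m n t - pos_part t - 1)..k}.
        (-1) ^ nat (k - j) * alpha q L r a b m n t j
        * (\<Sum>(g, h)\<in>{(g :: nat, h :: nat). int g + int h = k - j}.
             qbinom q (p_ind r m n t + 1) (int h) * qbinom q (pos_part t) (int g)
             * q ^ ((h * (h - 1) + g * (g - 1)) div 2) * W_arg q L r a b t ^ h))"

(* The summation bound K on the right-hand side of the identity; only alpha j with
   - max_ind r n \<le> j \<le> K occur there. *)
definition top_ind :: "nat \<Rightarrow> (nat \<Rightarrow> int) \<Rightarrow> (nat \<Rightarrow> int) \<Rightarrow> int \<Rightarrow> int" where
  "top_ind r m n t = p_ind r m n t + pos_part t - min_ind r m"

(* No denominator in the identity vanishes.  First clause: denominators of the left-hand side; it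
   excludes q^(a_i - a_l) from the integer powers of q, hence also covers
   (q^(a_i - a_l);q)_(n_l+j+1) and the lower parameters q^(1-a_i+a_l) in alpha j.
   Second clause: those hidden in (q^(1-b_l+a_i);q)_(m_l+j), and the lower parameters
   q^(b_l-a_i-m_l-j) of the series, which terminates at n = j + n_i. All remaining denominators
   are non-zero since 0 < |q| < 1 and |W| < 1. *)
definition no_vanishing_denominators ::
  "complex \<Rightarrow> complex \<Rightarrow> nat \<Rightarrow> (nat \<Rightarrow> complex) \<Rightarrow> (nat \<Rightarrow> complex) \<Rightarrow> (nat \<Rightarrow> int) \<Rightarrow> (nat \<Rightarrow> int)
     \<Rightarrow> int \<Rightarrow> bool" where
  "no_vanishing_denominators q L r a b m n t \<longleftrightarrow>
     (\<forall>i\<in>{1..r}. \<forall>l\<in>{1..r} - {i}. qpoch_inf (qpow L (a i - a l)) q \<noteq> 0) \<and>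
     (\<forall>j\<in>{- max_ind r n..top_ind r m n t}. \<forall>i\<in>{1..r}. \<forall>l\<in>{1..r}.
        j + n i \<ge> 0 \<longrightarrow>
          qpoch_defined (qpow L (1 - b l + a i)) q (m l + j) \<and>
          qpoch (qpow L (b l - a i - of_int (m l) - of_int j)) q (j + n i) \<noteq> 0)"

end

theory Submission
  imports Defs "HOL-Computational_Algebra.Polynomial"
begin

text \<open>Write \<open>A\<^sub>i = q^a\<^sub>i\<close> and \<open>B\<^sub>i = q^b\<^sub>i\<close>. The proof computes one sequence, \<open>\<alpha>\<^sub>j\<close>, in two ways.

Reversing the factors of its terminating series shows that \<open>\<alpha>\<^sub>j\<close> is the coefficient of \<open>z^j\<close> in
\<open>\<Sum>\<^sub>i A\<^sub>i^(1-t) \<phi>\<^sub>i(W z) D\<^sub>i(z)\<close>, where \<open>\<phi>\<^sub>i(W)\<close> is the \<open>i\<close>-th series on the left-hand side and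
the coefficients of \<open>D\<^sub>i\<close> are quotients of finite shifted factorials that converge to the
quotient of infinite products in front of \<open>\<phi>\<^sub>i\<close>, divided by \<open>(q;q)\<^sub>\<infinity>\<close> (\<open>reversed_series\<close>). By
Tannery's theorem \<open>\<alpha>\<^sub>j\<close> tends to the left-hand side divided by \<open>(q;q)\<^sub>\<infinity>\<close>
(\<open>cauchy_coeff_LIMSEQ\<close>).

On the other hand, once all \<open>m\<^sub>l + j\<close> are nonnegative, \<open>- \<alpha>\<^sub>j\<close> is the sum of the residues of
\<open>x^(-t) g\<^sub>j(x)\<close> at its nonzero finite poles \<open>A\<^sub>i q^(-k)\<close>, \<open>0 \<le> k \<le> j + n\<^sub>i\<close>, where
\<open>g\<^sub>j(x) = \<Prod>\<^sub>l (q x/B\<^sub>l;q)\<^sub>m\<^sub>l\<^sub>+\<^sub>j / \<Prod>\<^sub>l (x/A\<^sub>l;q)\<^sub>n\<^sub>l\<^sub>+\<^sub>j\<^sub>+\<^sub>1\<close> (\<open>residue_eq_product\<close>). It is therefore governed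
by the expansions of \<open>g\<^sub>j\<close> at \<open>0\<close> and at \<open>\<infinity>\<close>. The coefficients of these are combinations of
the geometric sequences \<open>q^(s j)\<close> with \<open>0 \<le> s < t\<close> and \<open>(W q^s)^j\<close> with \<open>0 \<le> s \<le> p\<close>, so that
\<open>\<Prod>\<^sub>s (1 - q^s S) \<Prod>\<^sub>s (1 - W q^s S)\<close>, with \<open>S\<close> the shift \<open>j \<mapsto> j - 1\<close>, annihilates \<open>\<alpha>\<close>. No expansion
is needed to see this: the factors are applied one after the other to the rational functions
themselves. Each factor \<open>1 - q^s S\<close> makes the numerator vanish to one more order at \<open>0\<close>
(\<open>next_poly_raises_order\<close>) and each factor \<open>1 - W q^s S\<close> lowers its degree by one
(\<open>next_poly_lowers_degree\<close>), until no residue is left at \<open>0\<close> or \<open>\<infinity>\<close> and the sum over the other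
poles is zero by Lagrange interpolation (\<open>residue_sum_vanishes\<close>, \<open>cauchy_coeff_recurrence\<close>).

By the q-binomial theorem \<open>\<beta>\<close> is this operator applied to \<open>\<alpha>\<close>, so \<open>\<beta>\<^sub>k = 0\<close> beyond the upper
summation bound. For \<open>t \<ge> 1\<close> the operator contains the factor \<open>1 - S\<close>, the sum of the
\<open>\<beta>\<^sub>k\<close> telescopes, and it equals \<open>(q;q)\<^sub>t\<^sub>-\<^sub>1 (W;q)\<^sub>p\<^sub>+\<^sub>1 lim \<alpha>\<^sub>j\<close>. For \<open>t \<le> 0\<close> the operator multiplies
constants by \<open>(W;q)\<^sub>p\<^sub>+\<^sub>1 \<noteq> 0\<close>, which forces \<open>lim \<alpha>\<^sub>j = 0\<close>.\<close>

section \<open>Shifted factorials of integer index\<close>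

lemma qpoch_nat: "qpoch a q (int N) = (\<Prod>k<N. 1 - a * q ^ k)"
  by (simp add: qpoch_def)

lemma qpoch_0 [simp]: "qpoch a q 0 = 1"
  by (simp add: qpoch_def)

lemma qpoch_neg: "qpoch a q (- int N) = (\<Prod>k=1..N. 1 / (1 - a * q powi (- int k)))"
  by (cases "N = 0") (auto simp: qpoch_def)

text \<open>For negative \<open>n\<close> the factor stands in a denominator of \<open>(a;q)\<^sub>n\<close> and is cancelled, hence the
side condition.\<close>

lemma qpoch_step:
  assumes "q \<noteq> 0" and "n \<ge> 0 \<or> 1 - a * q powi n \<noteq> 0"
  shows "qpoch a q (n + 1) = (1 - a * q powi n) * qpoch a q n"
proof (cases "n \<ge> 0")
  case True
  then obtain N where N: "n = int N" using nonneg_int_cases by blast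
  have "qpoch a q (int (Suc N)) = (1 - a * q ^ N) * qpoch a q (int N)"
    unfolding qpoch_nat by simp
  then show ?thesis by (simp add: N add.commute)
next
  case False
  define N where "N = nat (- n - 1)"
  have n: "n = - int (Suc N)" and n1: "n + 1 = - int N" using False by (auto simp: N_def)
  have "qpoch a q n = qpoch a q (n + 1) * (1 / (1 - a * q powi n))"
    unfolding n1 unfolding n qpoch_neg by simp
  then show ?thesis using assms False by simp
qed

lemma qpoch_shift:
  assumes "q \<noteq> 0" and "n \<ge> 1 \<or> a \<noteq> 1"
  shows "qpoch a q n = (1 - a) * qpoch (a * q) q (n - 1)"
proof (cases "n \<ge> 1")
  case True
  define N where "N = nat (n - 1)"
  have n: "n = int (Suc N)" and n1: "n - 1 = int N" using True by (auto simp: N_def)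
  show ?thesis unfolding n1 unfolding n qpoch_nat
    by (simp add: prod.lessThan_Suc_shift mult.assoc del: prod.lessThan_Suc)
next
  case False
  define N where "N = nat (- n)"
  have n: "n = - int N" and n1: "n - 1 = - int (Suc N)" using False by (auto simp: N_def)
  have "qpoch (a * q) q (n - 1) = (\<Prod>k=1..Suc N. 1 / (1 - a * q powi (1 - int k)))"
    unfolding n1 qpoch_neg using assms(1) by (simp add: mult.assoc flip: power_int_add_1')
  also have "\<dots> = (1 / (1 - a)) * (\<Prod>k=Suc 1..Suc N. 1 / (1 - a * q powi (1 - int k)))"
    by (subst prod.atLeast_Suc_atMost) auto
  also have "(\<Prod>k=Suc 1..Suc N. 1 / (1 - a * q powi (1 - int k))) = qpoch a q n"
    unfolding n qpoch_neg by (subst prod.shift_bounds_cl_Suc_ivl) simp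
  finally show ?thesis using assms False by simp
qed

lemma qpoch_concat:
  assumes "q \<noteq> 0" and "qpoch_defined a q M"
  shows "qpoch a q (M + int k) = qpoch a q M * qpoch (a * q powi M) q (int k)"
proof (induction k)
  case (Suc k)
  have "M + int k \<ge> 0 \<or> 1 - a * q powi (M + int k) \<noteq> 0"
  proof (cases "M + int k \<ge> 0")
    case False
    then have "nat (- (M + int k)) \<in> {1..nat (- M)}" by auto
    with assms(2) have "1 - a * q powi (- int (nat (- (M + int k)))) \<noteq> 0"
      unfolding qpoch_defined_def by blast
    moreover have "- int (nat (- (M + int k))) = M + int k" using False by simp
    ultimately show ?thesis by metis
  qed simp
  from qpoch_step[OF assms(1) this]
  have "qpoch a q (M + int (Suc k)) = (1 - a * q powi (M + int k)) * qpoch a q (M + int k)"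
    by (simp add: algebra_simps)
  moreover have "qpoch (a * q powi M) q (int (Suc k))
      = (1 - a * q powi (M + int k)) * qpoch (a * q powi M) q (int k)"
    unfolding qpoch_nat using assms(1) by (simp add: power_int_add mult.assoc mult.commute)
  ultimately show ?case using Suc by simp
qed simp

lemma qpoch_split:
  assumes "q \<noteq> 0" and "qpoch_defined (a * q ^ k) q M"
  shows "qpoch a q (int k + M) = qpoch a q (int k) * qpoch (a * q ^ k) q M"
  using assms(2)
proof (induction k arbitrary: a)
  case (Suc k)
  have "int (Suc k) + M \<ge> 1 \<or> a \<noteq> 1"
  proof (cases "int (Suc k) + M \<ge> 1")
    case False
    then have "Suc k \<in> {1..nat (- M)}" by auto
    with Suc.prems have "1 - a * q ^ Suc k * q powi (- int (Suc k)) \<noteq> 0"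
      unfolding qpoch_defined_def by blast
    moreover have "q ^ Suc k * q powi (- int (Suc k)) = 1"
      unfolding power_int_minus power_int_of_nat using assms(1) by (intro right_inverse) simp
    ultimately have "a \<noteq> 1" by (metis mult.assoc mult_1 right_minus_eq)
    then show ?thesis by simp
  qed simp
  from qpoch_shift[OF assms(1) this]
  have "qpoch a q (int (Suc k) + M) = (1 - a) * qpoch (a * q) q (int k + M)" by simp
  also have "\<dots> = (1 - a) * qpoch (a * q) q (int k) * qpoch (a * q * q ^ k) q M"
    using Suc.IH[of "a * q"] Suc.prems by (simp add: mult.assoc)
  also have "(1 - a) * qpoch (a * q) q (int k) = qpoch a q (int (Suc k))"
    using qpoch_shift[OF assms(1), of "int (Suc k)" a] by simp
  finally show ?case by (simp add: mult.assoc)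
qed simp

text \<open>The value \<open>(-1)^k q^(-k(k-1)/2)\<close>, kept as a product: it occurs equally often in numerator
and denominator of every balanced quotient below and only has to cancel.\<close>

definition rev_factor :: "complex \<Rightarrow> nat \<Rightarrow> complex" where
  "rev_factor q k = (\<Prod>u<k. - (1 / q ^ u))"

lemma rev_factor_nonzero: "q \<noteq> 0 \<Longrightarrow> rev_factor q k \<noteq> 0"
  by (simp add: rev_factor_def)

lemma qpoch_reverse:
  assumes "q \<noteq> 0" and "y \<noteq> 0"
  shows "qpoch (y * q powi (1 - int k)) q (int k) = y ^ k * rev_factor q k * qpoch (1 / y) q (int k)"
proof -
  have "qpoch (y * q powi (1 - int k)) q (int k)
      = (\<Prod>u<k. 1 - y * q powi (1 - int k) * q ^ (k - Suc u))"
    unfolding qpoch_nat by (rule prod.nat_diff_reindex[symmetric])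
  also have "\<dots> = (\<Prod>u<k. y * (- (1 / q ^ u)) * (1 - 1 / y * q ^ u))"
  proof (rule prod.cong)
    fix u assume "u \<in> {..<k}"
    then have "q powi (1 - int k) * q ^ (k - Suc u) = 1 / q ^ u"
      using assms(1) by (simp flip: power_int_add power_int_of_nat add: of_nat_diff power_int_minus_divide)
    then have "y * q powi (1 - int k) * q ^ (k - Suc u) = y * (1 / q ^ u)"
      by (simp only: mult.assoc)
    then show "1 - y * q powi (1 - int k) * q ^ (k - Suc u) = y * (- (1 / q ^ u)) * (1 - 1 / y * q ^ u)"
      using assms by (simp add: field_simps)
  qed simp
  also have "\<dots> = y ^ k * rev_factor q k * qpoch (1 / y) q (int k)"
    unfolding qpoch_nat rev_factor_def by (simp only: prod.distrib prod_constant card_lessThan)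
  finally show ?thesis .
qed

text \<open>Splits the last \<open>k\<close> factors off \<open>(a;q)\<^sub>N\<close> and reads them backwards. This turns a series
whose parameters depend on \<open>N\<close> into a convolution.\<close>

lemma qpoch_pull_top:
  assumes "q \<noteq> 0" and "a \<noteq> 0" and "qpoch_defined a q (N - int k)"
  shows "qpoch a q N = qpoch a q (N - int k) * ((a * q powi (N - 1)) ^ k * rev_factor q k
           * qpoch (q powi (1 - N) / a) q (int k))"
proof -
  have y: "a * q powi (N - 1) * q powi (1 - int k) = a * q powi (N - int k)"
    using assms(1) by (simp add: mult.assoc flip: power_int_add)
  have y': "1 / (a * q powi (N - 1)) = q powi (1 - N) / a"
    using assms(1) by (simp add: power_int_diff field_simps)
  show ?thesis
    using qpoch_concat[OF assms(1,3), of k] qpoch_reverse[OF assms(1), of "a * q powi (N - 1)" k] assms(1,2)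
    by (simp add: y y')
qed

lemma qpoch_nonzero:
  assumes "\<And>k::int. a * q powi k \<noteq> 1"
  shows "qpoch a q N \<noteq> 0"
proof -
  have "1 - a * q ^ k \<noteq> 0" for k using assms[of "int k"] by simp
  moreover have "1 - a * q powi (- int k) \<noteq> 0" for k using assms[of "- int k"] by simp
  ultimately show ?thesis unfolding qpoch_def by auto
qed

lemma qpoch_defined_generic:
  assumes "\<And>k::int. a * q powi k \<noteq> 1"
  shows "qpoch_defined a q N"
  unfolding qpoch_defined_def using assms by (metis right_minus_eq)

lemma qpoch_defined_mono: "qpoch_defined a q M \<Longrightarrow> M \<le> N \<Longrightarrow> qpoch_defined a q N"
  unfolding qpoch_defined_def by auto

lemma convergent_qpoch:
  assumes "norm q < 1"
  shows "convergent (\<lambda>n. qpoch a q (int n))"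
proof -
  have "summable (\<lambda>k. norm (1 - a * q ^ k - 1))"
    using assms by (simp add: norm_mult norm_power)
  then have "abs_convergent_prod (\<lambda>k. 1 - a * q ^ k)"
    by (rule summable_imp_abs_convergent_prod)
  then have "convergent_prod (\<lambda>k. 1 - a * q ^ k)"
    by (rule abs_convergent_prod_imp_convergent_prod)
  then have "convergent (\<lambda>n. \<Prod>k\<le>n. 1 - a * q ^ k)"
    by (rule convergent_prod_imp_convergent)
  then have "convergent (\<lambda>n. qpoch a q (int (Suc n)))"
    unfolding qpoch_nat by (simp add: lessThan_Suc_atMost)
  then show ?thesis using convergent_Suc_iff by blast
qed

lemma qpoch_LIMSEQ:
  assumes "norm q < 1"
  shows "(\<lambda>n. qpoch a q (int n)) \<longlonglongrightarrow> qpoch_inf a q"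
  unfolding qpoch_inf_def using convergent_qpoch[OF assms] by (simp add: convergent_LIMSEQ_iff)

text \<open>Sequences below are indexed by integers and start at varying negative indices; a limit does
not see the starting point.\<close>

lemma LIMSEQ_int_offset:
  assumes "(\<lambda>k. f (int k)) \<longlonglongrightarrow> (l::'a::topological_space)"
  shows "(\<lambda>k. f (c + int k)) \<longlonglongrightarrow> l"
proof -
  have "filterlim (\<lambda>k. nat (c + int k)) at_top sequentially"
    unfolding filterlim_at_top eventually_sequentially
  proof
    fix Z :: nat
    show "\<exists>N. \<forall>n\<ge>N. Z \<le> nat (c + int n)"
      by (rule exI[of _ "Z + nat (- c)"]) auto
  qed
  from filterlim_compose[OF assms this]
  have "(\<lambda>k. f (int (nat (c + int k)))) \<longlonglongrightarrow> l" .
  moreover have "\<forall>\<^sub>F k in sequentially. f (int (nat (c + int k))) = f (c + int k)"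
    unfolding eventually_sequentially by (rule exI[of _ "nat (- c)"]) auto
  ultimately show ?thesis by (rule Lim_transform_eventually)
qed

text \<open>A vanishing factor makes all later partial products zero, hence also the limit.\<close>

lemma qpoch_inf_nonzeroD:
  assumes "norm q < 1" and "qpoch_inf a q \<noteq> 0"
  shows "a * q ^ k \<noteq> 1"
proof
  assume "a * q ^ k = 1"
  then have "qpoch a q (int (Suc k) + int n) = 0" for n
    unfolding of_nat_add[symmetric] qpoch_nat by (intro prod_zero) (auto intro!: bexI[of _ k])
  then have "(\<lambda>n. qpoch a q (int (Suc k) + int n)) \<longlonglongrightarrow> 0" by simp
  with LIMSEQ_int_offset[OF qpoch_LIMSEQ[OF assms(1)], of "a" "int (Suc k)"] assms(2)
  show False using LIMSEQ_unique by blast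
qed

lemma qpoch_inf_nonzeroI:
  assumes "norm q < 1" and "\<And>k. a * q ^ k \<noteq> 1"
  shows "qpoch_inf a q \<noteq> 0"
proof -
  have "summable (\<lambda>k. norm (1 - a * q ^ k - 1))"
    using assms(1) by (simp add: norm_mult norm_power)
  then have "abs_convergent_prod (\<lambda>k. 1 - a * q ^ k)"
    by (rule summable_imp_abs_convergent_prod)
  then have c: "convergent_prod (\<lambda>k. 1 - a * q ^ k)"
    by (rule abs_convergent_prod_imp_convergent_prod)
  have nz: "1 - a * q ^ k \<noteq> 0" for k using assms(2)[of k] by simp
  have "(\<lambda>n. \<Prod>k\<le>n. 1 - a * q ^ k) \<longlonglongrightarrow> qpoch_inf a q"
    using LIMSEQ_Suc[OF qpoch_LIMSEQ[OF assms(1), of a]] unfolding qpoch_nat lessThan_Suc_atMost .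
  with convergent_prod_LIMSEQ[OF c] have "qpoch_inf a q = prodinf (\<lambda>k. 1 - a * q ^ k)"
    using LIMSEQ_unique by blast
  with prodinf_nonzero[OF c nz] show ?thesis by simp
qed

lemma qpoch_inf_split:
  assumes "q \<noteq> 0" and "norm q < 1"
  shows "qpoch_inf a q = qpoch a q (int k) * qpoch_inf (a * q ^ k) q"
proof -
  have "(\<lambda>n. qpoch a q (int k + int n)) \<longlonglongrightarrow> qpoch_inf a q"
    by (rule LIMSEQ_int_offset[OF qpoch_LIMSEQ[OF assms(2)]])
  moreover have "(\<lambda>n. qpoch a q (int k + int n)) \<longlonglongrightarrow> qpoch a q (int k) * qpoch_inf (a * q ^ k) q"
    using qpoch_split[OF assms(1), of a k "int n" for n]
    by (auto simp: qpoch_defined_def intro!: tendsto_mult_left qpoch_LIMSEQ[OF assms(2)])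
  ultimately show ?thesis using LIMSEQ_unique by blast
qed

section \<open>Lagrange interpolation as a residue theorem\<close>

text \<open>The sum is the leading coefficient of the interpolation polynomial of \<open>T\<close> at \<open>card I\<close>
nodes, and that polynomial is \<open>T\<close> itself, whose degree is too small.\<close>

lemma sum_divided_difference_zero:
  fixes x :: "'i \<Rightarrow> 'a::field"
  assumes "finite I" and "inj_on x I" and "degree T + 2 \<le> card I"
  shows "(\<Sum>i\<in>I. poly T (x i) / (\<Prod>i'\<in>I - {i}. x i - x i')) = 0"
proof -
  define N where "N i = (\<Prod>i'\<in>I - {i}. [:- x i', 1:])" for i
  define w where "w i = poly T (x i) / (\<Prod>i'\<in>I - {i}. x i - x i')" for i
  define P where "P = (\<Sum>i\<in>I. smult (w i) (N i))"
  have deg_N: "degree (N i) = card I - 1" if "i \<in> I" for i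
    unfolding N_def using assms(1) that by (subst degree_prod_sum_eq) auto
  have lead_N: "coeff (N i) (card I - 1) = 1" if "i \<in> I" for i
  proof -
    have "lead_coeff (N i) = 1" unfolding N_def by (simp add: lead_coeff_prod)
    with deg_N[OF that] show ?thesis by simp
  qed
  have at_node: "poly P (x i) = poly T (x i)" if i: "i \<in> I" for i
  proof -
    have "poly (N k) (x i) = 0" if "k \<in> I - {i}" for k
      using i that assms(1) unfolding N_def poly_prod by (intro prod_zero) auto
    then have "poly P (x i) = w i * poly (N i) (x i)"
      unfolding P_def poly_sum using i assms(1) by (subst sum.remove[of I i]) auto
    also have "poly (N i) (x i) = (\<Prod>i'\<in>I - {i}. x i - x i')"
      unfolding N_def poly_prod by simp
    also have "w i * \<dots> = poly T (x i)"
      unfolding w_def using i assms(1,2) by (auto dest: inj_onD)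
    finally show ?thesis .
  qed
  have "degree P \<le> card I - 1"
    unfolding P_def by (intro degree_sum_le) (use deg_N assms(1) in \<open>auto simp: le_trans[OF degree_smult_le]\<close>)
  moreover have "card (x ` I) = card I" using assms(2) by (rule card_image)
  ultimately have "P = T"
    using assms(3) at_node by (intro poly_eqI_degree[of "x ` I"]) auto
  with assms(3) have "coeff P (card I - 1) = 0" by (auto intro: coeff_eq_0)
  then have "(\<Sum>i\<in>I. w i) = 0" unfolding P_def coeff_sum using lead_N by simp
  then show ?thesis unfolding w_def .
qed

text \<open>The same fact for a denominator normalised to \<open>1\<close> at the origin: up to a common constant
the summand is the residue of \<open>T / \<Prod> (1 - x / x\<^sub>i)\<close> at \<open>x\<^sub>i\<close>. The bound on the degree says that
there is no residue at infinity.\<close>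

lemma sum_residues_zero:
  fixes x :: "'i \<Rightarrow> 'a::field"
  assumes "finite I" and "inj_on x I" and "\<And>i. i \<in> I \<Longrightarrow> x i \<noteq> 0" and "degree T + 2 \<le> card I"
  shows "(\<Sum>i\<in>I. x i * poly T (x i) / (\<Prod>i'\<in>I - {i}. 1 - x i / x i')) = 0"
proof -
  define X where "X = (- 1) ^ (card I - 1) * (\<Prod>i\<in>I. x i)"
  have "x i * poly T (x i) / (\<Prod>i'\<in>I - {i}. 1 - x i / x i')
      = X * (poly T (x i) / (\<Prod>i'\<in>I - {i}. x i - x i'))" if i: "i \<in> I" for i
  proof -
    have "(\<Prod>i'\<in>I - {i}. 1 - x i / x i') = (\<Prod>i'\<in>I - {i}. (- 1) * (x i - x i') / x i')"
      using assms(3) by (intro prod.cong) (auto simp: field_simps)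
    also have "\<dots> = (- 1) ^ (card I - 1) * (\<Prod>i'\<in>I - {i}. x i - x i') / (\<Prod>i'\<in>I - {i}. x i')"
      using i assms(1) by (simp only: prod_dividef prod.distrib prod_constant card_Diff_singleton)
    finally have "x i * poly T (x i) / (\<Prod>i'\<in>I - {i}. 1 - x i / x i')
        = 1 / (- 1) ^ (card I - 1) * (x i * (\<Prod>i'\<in>I - {i}. x i'))
          * (poly T (x i) / (\<Prod>i'\<in>I - {i}. x i - x i'))"
      by (simp add: mult_ac)
    moreover have "1 / (- 1) ^ (card I - 1) = ((- 1) ^ (card I - 1) :: 'a)"
      by (cases "even (card I - 1)") auto
    moreover have "x i * (\<Prod>i'\<in>I - {i}. x i') = (\<Prod>i\<in>I. x i)"
      using i assms(1) by (rule prod.remove[symmetric, rotated])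
    ultimately show ?thesis unfolding X_def by (simp only:)
  qed
  then have "(\<Sum>i\<in>I. x i * poly T (x i) / (\<Prod>i'\<in>I - {i}. 1 - x i / x i'))
      = X * (\<Sum>i\<in>I. poly T (x i) / (\<Prod>i'\<in>I - {i}. x i - x i'))"
    by (simp add: sum_distrib_left)
  with sum_divided_difference_zero[OF assms(1,2,4)] show ?thesis by simp
qed

section \<open>Polynomials in the shift and the q-binomial theorem\<close>

text \<open>The polynomial \<open>C\<close> evaluated at the shift operator \<open>f \<mapsto> (\<lambda>j. f (j - 1))\<close>, equivalently the
coefficient of \<open>z^j\<close> in \<open>C(z) \<Sum> f\<^sub>j z^j\<close>.\<close>

definition shift_comb :: "complex poly \<Rightarrow> (int \<Rightarrow> complex) \<Rightarrow> int \<Rightarrow> complex" where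
  "shift_comb C f j = (\<Sum>i\<le>degree C. coeff C i * f (j - int i))"

lemma shift_comb_le:
  assumes "degree C \<le> N"
  shows "shift_comb C f j = (\<Sum>i\<le>N. coeff C i * f (j - int i))"
  unfolding shift_comb_def using assms by (intro sum.mono_neutral_left) (auto simp: coeff_eq_0)

lemma shift_comb_1: "shift_comb 1 f j = f j"
  by (simp add: shift_comb_def)

lemma shift_comb_linear_factor:
  "shift_comb ([:1, - c:] * C) f j = shift_comb C f j - c * shift_comb C f (j - 1)"
proof -
  have deg: "degree ([:1, - c:] * C) \<le> Suc (degree C)"
    using degree_mult_le[of "[:1, - c:]" C] by (auto split: if_splits)
  have "shift_comb ([:1, - c:] * C) f j
      = (\<Sum>i\<le>Suc (degree C). coeff C i * f (j - int i))
        - (\<Sum>i\<le>Suc (degree C). c * (case i of 0 \<Rightarrow> 0 | Suc k \<Rightarrow> coeff C k) * f (j - int i))"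
    unfolding shift_comb_le[OF deg] sum_subtractf[symmetric]
    by (intro sum.cong) (auto simp: coeff_pCons algebra_simps split: nat.split)
  also have "(\<Sum>i\<le>Suc (degree C). coeff C i * f (j - int i)) = shift_comb C f j"
    by (rule shift_comb_le[symmetric]) simp
  also have "(\<Sum>i\<le>Suc (degree C). c * (case i of 0 \<Rightarrow> 0 | Suc k \<Rightarrow> coeff C k) * f (j - int i))
      = c * shift_comb C f (j - 1)"
    unfolding shift_comb_def
    by (subst sum.atMost_Suc_shift) (simp add: sum_distrib_left algebra_simps)
  finally show ?thesis .
qed

lemma shift_comb_LIMSEQ:
  assumes "(\<lambda>k. f (int k)) \<longlonglongrightarrow> l"
  shows "(\<lambda>k. shift_comb C f (int k)) \<longlonglongrightarrow> poly C 1 * l"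
proof -
  have "(\<lambda>k. f (- int i + int k)) \<longlonglongrightarrow> l" for i by (rule LIMSEQ_int_offset[OF assms])
  then have "(\<lambda>k. f (int k - int i)) \<longlonglongrightarrow> l" for i by simp
  then have "(\<lambda>k. shift_comb C f (int k)) \<longlonglongrightarrow> (\<Sum>i\<le>degree C. coeff C i * l)"
    unfolding shift_comb_def by (intro tendsto_intros)
  then show ?thesis by (simp add: poly_altdef sum_distrib_right)
qed

lemma qpoch_self_nonzero:
  assumes "q \<noteq> 0" and "norm q < 1"
  shows "qpoch q q (int N) \<noteq> 0"
proof -
  have "q ^ Suc k \<noteq> 1" for k
  proof
    assume "q ^ Suc k = 1"
    then have "norm q ^ Suc k = 1" by (metis norm_power norm_one)
    with assms(2) show False using power_less_one_iff[of "norm q" "Suc k"] by simp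
  qed
  then show ?thesis unfolding qpoch_nat by (auto simp flip: power_Suc)
qed

lemma qbinom_nat:
  "qbinom q (int N) (int h) = (if h \<le> N then qpoch q q (int N) / (qpoch q q (int h) * qpoch q q (int (N - h))) else 0)"
  by (simp add: qbinom_def of_nat_diff)

text \<open>The q-Pascal rule, from \<open>1 - q^(N+1) = (1 - q^(N-h)) + q^(N-h) (1 - q^(h+1))\<close>.\<close>

lemma qbinom_Suc:
  assumes "q \<noteq> 0" and "norm q < 1"
  shows "qbinom q (int (Suc N)) (int (Suc h)) = qbinom q (int N) (int (Suc h)) + q ^ (N - h) * qbinom q (int N) (int h)"
proof -
  have step: "qpoch q q (int (Suc k)) = (1 - q ^ Suc k) * qpoch q q (int k)" for k
    unfolding qpoch_nat by simp
  note nz = qpoch_self_nonzero[OF assms]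
  have nz1: "1 - q ^ Suc k \<noteq> 0" for k using nz[of "Suc k"] unfolding step by auto
  consider "h < N" | "h = N" | "h > N" by linarith
  then show ?thesis
  proof cases
    case 1
    then obtain d where d: "N = Suc (h + d)" using less_imp_Suc_add by blast
    have "N - h = Suc d" "Suc N - Suc h = Suc d" "N - Suc h = d" using d by auto
    note * = this
    have e: "1 - q ^ Suc N = (1 - q ^ Suc d) + q ^ Suc d * (1 - q ^ Suc h)"
      using d by (simp add: algebra_simps flip: power_add)
    have "qpoch q q (int (Suc N)) / (qpoch q q (int (Suc h)) * qpoch q q (int (Suc d)))
        = qpoch q q (int N) / (qpoch q q (int (Suc h)) * qpoch q q (int d))
          + q ^ Suc d * (qpoch q q (int N) / (qpoch q q (int h) * qpoch q q (int (Suc d))))"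
      unfolding step e using nz[of h] nz[of d] nz1[of h] nz1[of d]
      by (simp add: divide_simps del: power_Suc) (simp add: algebra_simps del: power_Suc)
    then show ?thesis unfolding qbinom_nat * using 1 by simp
  next
    case 2
    then show ?thesis unfolding qbinom_nat using nz[of "Suc N"] nz[of N] by simp
  next
    case 3
    then show ?thesis unfolding qbinom_nat by simp
  qed
qed

definition qpoch_poly :: "complex \<Rightarrow> complex \<Rightarrow> nat \<Rightarrow> complex poly" where
  "qpoch_poly w q N = (\<Prod>s<N. [:1, - (w * q ^ s):])"

lemma poly_qpoch_poly: "poly (qpoch_poly w q N) x = qpoch (w * x) q (int N)"
  unfolding qpoch_poly_def qpoch_nat poly_prod by (simp add: algebra_simps)

lemma degree_qpoch_poly: "degree (qpoch_poly w q N) \<le> N"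
proof -
  have "degree (qpoch_poly w q N) \<le> (\<Sum>s<N. degree [:1, - (w * q ^ s):])"
    unfolding qpoch_poly_def by (rule degree_prod_sum_le[unfolded comp_def]) simp
  also have "\<dots> \<le> (\<Sum>s<N. 1)" by (intro sum_mono) auto
  finally show ?thesis by simp
qed

text \<open>The finite q-binomial theorem, by induction on \<open>N\<close> with the q-Pascal rule.\<close>

lemma coeff_qpoch_poly:
  assumes "q \<noteq> 0" and "norm q < 1"
  shows "coeff (qpoch_poly w q N) h
    = (- 1) ^ h * qbinom q (int N) (int h) * q ^ (h * (h - 1) div 2) * w ^ h"
proof (induction N arbitrary: h)
  case 0
  show ?case by (cases h) (auto simp: qpoch_poly_def qbinom_def)
next
  case (Suc N)
  have rec: "qpoch_poly w q (Suc N) = [:1, - (w * q ^ N):] * qpoch_poly w q N"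
    by (simp add: qpoch_poly_def mult.commute)
  show ?case
  proof (cases h)
    case 0
    then show ?thesis unfolding rec using Suc.IH[of 0] qpoch_self_nonzero[OF assms, of N] qpoch_self_nonzero[OF assms, of "Suc N"]
      by (simp add: qbinom_def coeff_pCons)
  next
    case (Suc k)
    have tri: "Suc k * (Suc k - 1) div 2 = k * (k - 1) div 2 + k"
    proof -
      have "Suc k * k = k * (k - 1) + k * 2" by (cases k) auto
      then show ?thesis by simp
    qed
    have "coeff (qpoch_poly w q (Suc N)) (Suc k)
        = coeff (qpoch_poly w q N) (Suc k) - w * q ^ N * coeff (qpoch_poly w q N) k"
      unfolding rec by (simp add: coeff_pCons)
    also have "\<dots> = (- 1) ^ Suc k * q ^ (Suc k * (Suc k - 1) div 2) * w ^ Suc k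
        * (qbinom q (int N) (int (Suc k)) + q ^ (N - k) * qbinom q (int N) (int k))"
    proof (cases "k \<le> N")
      case True
      then have "q ^ N = q ^ k * q ^ (N - k)" by (simp flip: power_add)
      then show ?thesis unfolding Suc.IH tri by (simp add: power_add algebra_simps)
    next
      case False
      then show ?thesis unfolding Suc.IH by (simp add: qbinom_def)
    qed
    finally show ?thesis unfolding \<open>h = Suc k\<close> qbinom_Suc[OF assms] by (simp add: mult.commute)
  qed
qed

section \<open>Sums over the poles and their recurrence\<close>

text \<open>The coefficient at a bound for the degree, as opposed to the degree itself: the bounds
below need not be attained.\<close>

lemma coeff_mult_top:
  assumes "degree p \<le> a" and "degree s \<le> b"
  shows "coeff (p * s) (a + b) = coeff p a * coeff s b"
proof -
  have "coeff (p * s) (a + b) = (\<Sum>i\<le>a + b. coeff p i * coeff s (a + b - i))" by (rule coeff_mult)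
  also have "\<dots> = (\<Sum>i\<in>{a}. coeff p i * coeff s (a + b - i))"
  proof (rule sum.mono_neutral_right)
    show "\<forall>i\<in>{..a + b} - {a}. coeff p i * coeff s (a + b - i) = 0"
    proof
      fix i assume i: "i \<in> {..a + b} - {a}"
      show "coeff p i * coeff s (a + b - i) = 0"
      proof (cases "i > a")
        case True
        with assms(1) show ?thesis by (simp add: coeff_eq_0)
      next
        case False
        with i assms(2) show ?thesis by (simp add: coeff_eq_0)
      qed
    qed
  qed auto
  finally show ?thesis by simp
qed

text \<open>The data of the identity in terms of \<open>A\<^sub>i = q^a\<^sub>i\<close> and \<open>B\<^sub>i = q^b\<^sub>i\<close>. The assumption
\<open>A_generic\<close> makes all poles simple. The assumption \<open>numer_defined\<close> concerns the coefficients
\<open>tail_coeff i s\<close>, whose first index is \<open>s = - n i\<close>; it passes to all larger \<open>s\<close>.\<close>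

locale residue_data =
  fixes r :: nat and q :: complex and A B :: "nat \<Rightarrow> complex" and m n :: "nat \<Rightarrow> int" and t :: int
  assumes q_nonzero: "q \<noteq> 0" and q_lt_1: "norm q < 1" and r_pos: "r \<ge> 1"
    and A_nonzero: "\<And>i. i \<in> {1..r} \<Longrightarrow> A i \<noteq> 0"
    and B_nonzero: "\<And>i. i \<in> {1..r} \<Longrightarrow> B i \<noteq> 0"
    and A_generic: "\<And>i l k. i \<in> {1..r} \<Longrightarrow> l \<in> {1..r} \<Longrightarrow> i \<noteq> l \<Longrightarrow> A i / A l * q powi k \<noteq> 1"
    and numer_defined: "\<And>i l. i \<in> {1..r} \<Longrightarrow> l \<in> {1..r} \<Longrightarrow> qpoch_defined (q * A i / B l) q (m l - n i)"
begin

definition poles :: "int \<Rightarrow> nat \<Rightarrow> nat" where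
  "poles j i = nat (j + n i + 1)"

definition node :: "nat \<Rightarrow> nat \<Rightarrow> complex" where
  "node i k = A i / q ^ k"

definition numer :: "int \<Rightarrow> complex \<Rightarrow> complex" where
  "numer j x = (\<Prod>l=1..r. qpoch (q * x / B l) q (m l + j))"

text \<open>The denominator \<open>\<Prod>\<^sub>l (x/A\<^sub>l;q)\<^sub>n\<^sub>l\<^sub>+\<^sub>j\<^sub>+\<^sub>1\<close> of \<open>g\<^sub>j\<close> without its factor \<open>1 - x / node i k\<close>, evaluated at
\<open>x = node i k\<close>.\<close>

definition punctured_denom :: "int \<Rightarrow> nat \<Rightarrow> nat \<Rightarrow> complex" where
  "punctured_denom j i k = qpoch (1 / q ^ k) q (int k) * qpoch q q (j + n i - int k)
     * (\<Prod>l\<in>{1..r} - {i}. qpoch (node i k / A l) q (n l + j + 1))"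

text \<open>Minus the sum of the residues of \<open>x^(-t) g(x)\<close> at the nonzero finite poles, for the rational
function \<open>g\<close> with the numerator of \<open>g\<^sub>j\<^sub>-\<^sub>s\<close> multiplied by \<open>\<Phi>(q^j x)\<close> and the denominator of \<open>g\<^sub>j\<close>.
Functions of this form are what remains of \<open>g\<^sub>j\<close> after \<open>s\<close> linear factors in the shift:
the smallest numerator and the largest denominator that are involved are common to all
terms, and the rest depends on \<open>q^j x\<close> only.\<close>

definition residue_sum :: "nat \<Rightarrow> int \<Rightarrow> complex poly \<Rightarrow> complex" where
  "residue_sum s j \<Phi> = (\<Sum>i=1..r. \<Sum>k<poles j i.
     node i k powi (1 - t) * numer (j - int s) (node i k) * poly \<Phi> (q powi j * node i k) / punctured_denom j i k)"

text \<open>The numerator of \<open>g\<^sub>j / g\<^sub>j\<^sub>-\<^sub>1\<close> as a polynomial in \<open>q^j x\<close>.\<close>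

definition numer_step :: "complex poly" where
  "numer_step = (\<Prod>l=1..r. [:1, - (q powi m l / B l):])"

definition denom_step :: "complex poly" where
  "denom_step = (\<Prod>l=1..r. [:1, - (q powi n l / A l):])"

text \<open>With \<open>U = numer_step\<close> and \<open>V = denom_step\<close> this is \<open>U(q^(-s) y) \<Phi>(y) - c V(y) \<Phi>(y/q)\<close>, the
effect of the factor \<open>1 - c S\<close>, with \<open>S\<close> the shift \<open>j \<mapsto> j - 1\<close>, on the polynomial \<open>\<Phi>\<close> of
\<open>residue_sum\<close> after \<open>s\<close> earlier factors.\<close>

definition next_poly :: "nat \<Rightarrow> complex \<Rightarrow> complex poly \<Rightarrow> complex poly" where
  "next_poly s c \<Phi> = pcompose numer_step (monom (q powi (- int s)) 1) * \<Phi>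
     - smult c (denom_step * pcompose \<Phi> (monom (1 / q) 1))"

lemma node_nonzero: "i \<in> {1..r} \<Longrightarrow> node i k \<noteq> 0"
  using A_nonzero q_nonzero by (simp add: node_def)

lemma node_generic:
  assumes "i \<in> {1..r}" and "l \<in> {1..r}" and "i \<noteq> l"
  shows "node i k / A l * q powi e \<noteq> 1"
  using A_generic[OF assms, of "e - int k"] q_nonzero
  by (simp add: node_def power_int_diff mult.commute)

lemma punctured_denom_nonzero:
  assumes "i \<in> {1..r}" and "k < poles j i"
  shows "punctured_denom j i k \<noteq> 0"
proof -
  have "qpoch (1 / q ^ k) q (int k) \<noteq> 0"
    using qpoch_reverse[OF q_nonzero, of "1 / q" k] rev_factor_nonzero[OF q_nonzero]
      qpoch_self_nonzero[OF q_nonzero q_lt_1] q_nonzero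
    by (simp add: power_int_diff)
  moreover have "j + n i - int k = int (nat (j + n i - int k))"
    using assms(2) by (simp add: poles_def)
  then have "qpoch q q (j + n i - int k) \<noteq> 0"
    using qpoch_self_nonzero[OF q_nonzero q_lt_1] by metis
  ultimately show ?thesis
    unfolding punctured_denom_def using qpoch_nonzero node_generic[OF assms(1)] by auto
qed

lemma numer_rec:
  assumes "\<And>l. l \<in> {1..r} \<Longrightarrow> m l + j \<ge> 1"
  shows "numer j x = numer (j - 1) x * poly numer_step (q powi j * x)"
proof -
  have "qpoch (q * x / B l) q (m l + j)
      = qpoch (q * x / B l) q (m l + (j - 1)) * (1 - q powi m l / B l * (q powi j * x))"
    if "l \<in> {1..r}" for l
  proof -
    have e: "q * x / B l * q powi (m l + (j - 1)) = q powi m l / B l * (q powi j * x)"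
      using q_nonzero by (simp add: power_int_add power_int_diff)
    have "m l + j = m l + (j - 1) + 1" by simp
    moreover have "qpoch (q * x / B l) q (m l + (j - 1) + 1)
        = (1 - q * x / B l * q powi (m l + (j - 1))) * qpoch (q * x / B l) q (m l + (j - 1))"
      using assms[OF that] by (intro qpoch_step[OF q_nonzero]) simp
    ultimately show ?thesis unfolding e by (simp only: mult.commute)
  qed
  then have "numer j x = (\<Prod>l=1..r. qpoch (q * x / B l) q (m l + (j - 1))
      * (1 - q powi m l / B l * (q powi j * x)))"
    unfolding numer_def by (intro prod.cong refl)
  then show ?thesis
    unfolding numer_def numer_step_def poly_prod prod.distrib by (simp add: mult_ac)
qed

lemma punctured_denom_rec:
  assumes "i \<in> {1..r}" and "k < poles (j - 1) i"
  shows "punctured_denom j i k = punctured_denom (j - 1) i k * poly denom_step (q powi j * node i k)"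
proof -
  have other: "qpoch (node i k / A l) q (n l + j + 1)
      = qpoch (node i k / A l) q (n l + (j - 1) + 1) * (1 - q powi n l / A l * (q powi j * node i k))"
    if "l \<in> {1..r} - {i}" for l
  proof -
    have e: "node i k / A l * q powi (n l + j) = q powi n l / A l * (q powi j * node i k)"
      using q_nonzero by (simp add: power_int_add)
    have "node i k / A l * q powi (n l + j) \<noteq> 1"
      using that assms(1) by (intro node_generic) auto
    then have "qpoch (node i k / A l) q (n l + j + 1)
        = (1 - node i k / A l * q powi (n l + j)) * qpoch (node i k / A l) q (n l + j)"
      by (intro qpoch_step[OF q_nonzero] disjI2) simp
    moreover have "n l + (j - 1) + 1 = n l + j" by simp
    ultimately show ?thesis unfolding e by (simp only: mult.commute)
  qed
  have own: "qpoch q q (j + n i - int k)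
      = qpoch q q (j - 1 + n i - int k) * (1 - q powi n i / A i * (q powi j * node i k))"
  proof -
    have e: "q * q powi (j - 1 + n i - int k) = q powi n i / A i * (q powi j * node i k)"
      using q_nonzero A_nonzero[OF assms(1)] by (simp add: power_int_add power_int_diff node_def)
    have "j + n i - int k = j - 1 + n i - int k + 1" by simp
    moreover have "qpoch q q (j - 1 + n i - int k + 1)
        = (1 - q * q powi (j - 1 + n i - int k)) * qpoch q q (j - 1 + n i - int k)"
      using assms(2) by (intro qpoch_step[OF q_nonzero] disjI1) (auto simp: poles_def)
    ultimately show ?thesis unfolding e by (simp only: mult.commute)
  qed
  have step: "poly denom_step (q powi j * node i k) = (1 - q powi n i / A i * (q powi j * node i k))
      * (\<Prod>l\<in>{1..r} - {i}. 1 - q powi n l / A l * (q powi j * node i k))"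
    unfolding denom_step_def poly_prod using assms(1)
    by (subst prod.remove[of _ i]) (simp_all add: mult.commute)
  have others: "(\<Prod>l\<in>{1..r} - {i}. qpoch (node i k / A l) q (n l + j + 1))
      = (\<Prod>l\<in>{1..r} - {i}. qpoch (node i k / A l) q (n l + (j - 1) + 1))
        * (\<Prod>l\<in>{1..r} - {i}. 1 - q powi n l / A l * (q powi j * node i k))"
    unfolding prod.distrib[symmetric] by (intro prod.cong refl other)
  have "a * (b * v) * (D * E) = a * b * D * (v * E)" for a b v D E :: complex by simp
  then show ?thesis
    by (subst punctured_denom_def, subst own, subst others, subst step, subst punctured_denom_def)
qed

text \<open>The last pole of \<open>g\<^sub>j\<close> in each string is not a pole of \<open>g\<^sub>j\<^sub>-\<^sub>1\<close>. This zero allows the two sums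
to be taken over the same poles.\<close>

lemma poly_denom_step_last:
  assumes "i \<in> {1..r}" and "int k = j + n i"
  shows "poly denom_step (q powi j * node i k) = 0"
proof -
  have "q powi n i / A i * (q powi j * node i k) = 1"
    using A_nonzero[OF assms(1)] q_nonzero assms(2)
    by (simp add: node_def flip: power_int_of_nat) (simp add: power_int_add)
  then show ?thesis
    unfolding denom_step_def poly_prod using assms(1)
    by (intro prod_zero) (auto intro!: bexI[of _ i] simp: algebra_simps)
qed

lemma poly_pcompose_monom: "poly (pcompose P (monom (c::complex) 1)) x = poly P (c * x)"
  by (simp add: poly_pcompose poly_monom del: One_nat_def)

text \<open>Bring both sums to the numerator of index \<open>j - s - 1\<close> and the denominator of index \<open>j\<close>: the
first gains the factor \<open>U(q^(-s) y)\<close>, the second the factor \<open>V(y)\<close>, where \<open>y = q^j x\<close>.\<close>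

lemma residue_sum_step:
  assumes "\<And>l. l \<in> {1..r} \<Longrightarrow> m l + j - int s \<ge> 1"
  shows "residue_sum s j \<Phi> - c * residue_sum s (j - 1) \<Phi> = residue_sum (Suc s) j (next_poly s c \<Phi>)"
proof -
  let ?z = "\<lambda>i k. q powi j * node i k"
  have last: "(\<Sum>k<poles (j - 1) i.
        node i k powi (1 - t) * numer (j - 1 - int s) (node i k) * poly \<Phi> (q powi (j - 1) * node i k)
          / punctured_denom (j - 1) i k)
      = (\<Sum>k<poles j i. node i k powi (1 - t) * numer (j - 1 - int s) (node i k)
          * (poly denom_step (?z i k) * poly \<Phi> (1 / q * ?z i k)) / punctured_denom j i k)"
    if i: "i \<in> {1..r}" for i
  proof -
    have "(\<Sum>k<poles (j - 1) i.
        node i k powi (1 - t) * numer (j - 1 - int s) (node i k) * poly \<Phi> (q powi (j - 1) * node i k)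
          / punctured_denom (j - 1) i k)
      = (\<Sum>k<poles (j - 1) i. node i k powi (1 - t) * numer (j - 1 - int s) (node i k)
          * (poly denom_step (?z i k) * poly \<Phi> (1 / q * ?z i k)) / punctured_denom j i k)"
    proof (rule sum.cong)
      fix k assume k: "k \<in> {..<poles (j - 1) i}"
      then have "k < poles j i" by (auto simp: poles_def)
      with punctured_denom_nonzero[OF i] have "punctured_denom j i k \<noteq> 0" by blast
      with punctured_denom_rec[OF i, of k j] k
      have h1: "poly denom_step (?z i k) / punctured_denom j i k = 1 / punctured_denom (j - 1) i k" by simp
      have h2: "q powi (j - 1) * node i k = 1 / q * ?z i k"
        using q_nonzero by (simp add: power_int_diff)
      have regroup: "a * p / d' = a * (v * p) / d" if "v / d = 1 / d'" for a p v d d' :: complex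
      proof -
        have "a * (v * p) / d = a * p * (v / d)" by simp
        also have "\<dots> = a * p / d'" unfolding that by simp
        finally show ?thesis by (rule sym)
      qed
      show "node i k powi (1 - t) * numer (j - 1 - int s) (node i k)
            * poly \<Phi> (q powi (j - 1) * node i k) / punctured_denom (j - 1) i k
          = node i k powi (1 - t) * numer (j - 1 - int s) (node i k)
            * (poly denom_step (?z i k) * poly \<Phi> (1 / q * ?z i k)) / punctured_denom j i k"
        unfolding h2 by (rule regroup[OF h1])
    qed simp
    also have "\<dots> = (\<Sum>k<poles j i. node i k powi (1 - t) * numer (j - 1 - int s) (node i k)
          * (poly denom_step (?z i k) * poly \<Phi> (1 / q * ?z i k)) / punctured_denom j i k)"
    proof (rule sum.mono_neutral_left)
      show "{..<poles (j - 1) i} \<subseteq> {..<poles j i}" by (auto simp: poles_def)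
      show "\<forall>k\<in>{..<poles j i} - {..<poles (j - 1) i}. node i k powi (1 - t) * numer (j - 1 - int s) (node i k)
          * (poly denom_step (?z i k) * poly \<Phi> (1 / q * ?z i k)) / punctured_denom j i k = 0"
      proof
        fix k assume "k \<in> {..<poles j i} - {..<poles (j - 1) i}"
        then have "int k = j + n i" by (auto simp: poles_def)
        with poly_denom_step_last[OF i] show "node i k powi (1 - t) * numer (j - 1 - int s) (node i k)
          * (poly denom_step (?z i k) * poly \<Phi> (1 / q * ?z i k)) / punctured_denom j i k = 0" by simp
      qed
    qed simp
    finally show ?thesis .
  qed
  have num: "numer (j - int s) x = numer (j - 1 - int s) x * poly numer_step (q powi (- int s) * (q powi j * x))" for x
  proof -
    have "numer (j - int s) x = numer (j - int s - 1) x * poly numer_step (q powi (j - int s) * x)"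
      using assms by (intro numer_rec) force
    moreover have "j - int s - 1 = j - 1 - int s" by simp
    moreover have "q powi (j - int s) = q powi (- int s) * q powi j"
      using q_nonzero by (simp flip: power_int_add)
    ultimately show ?thesis by (simp only: mult.assoc)
  qed
  have regroup: "a * (N * u) * F / d - c * (a * N * (v * G) / d) = a * N * (u * F - c * (v * G)) / d"
    for a N u v F G d :: complex
    by (simp add: right_diff_distrib diff_divide_distrib mult_ac)
  show ?thesis
    unfolding residue_sum_def sum_distrib_left sum_subtractf[symmetric]
  proof (rule sum.cong)
    fix i assume i: "i \<in> {1..r}"
    show "(\<Sum>k<poles j i. node i k powi (1 - t) * numer (j - int s) (node i k) * poly \<Phi> (?z i k) / punctured_denom j i k)
        - (\<Sum>k<poles (j - 1) i. c * (node i k powi (1 - t) * numer (j - 1 - int s) (node i k)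
            * poly \<Phi> (q powi (j - 1) * node i k) / punctured_denom (j - 1) i k))
      = (\<Sum>k<poles j i. node i k powi (1 - t) * numer (j - int (Suc s)) (node i k)
            * poly (next_poly s c \<Phi>) (?z i k) / punctured_denom j i k)"
      unfolding sum_distrib_left[symmetric] last[OF i]
      unfolding sum_distrib_left sum_subtractf[symmetric]
    proof (rule sum.cong)
      fix k
      have e: "j - int (Suc s) = j - 1 - int s" by simp
      show "node i k powi (1 - t) * numer (j - int s) (node i k) * poly \<Phi> (?z i k) / punctured_denom j i k
          - c * (node i k powi (1 - t) * numer (j - 1 - int s) (node i k)
            * (poly denom_step (?z i k) * poly \<Phi> (1 / q * ?z i k)) / punctured_denom j i k)
        = node i k powi (1 - t) * numer (j - int (Suc s)) (node i k)
            * poly (next_poly s c \<Phi>) (?z i k) / punctured_denom j i k"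
        unfolding e num[of "node i k"] next_poly_def poly_diff poly_mult poly_smult poly_pcompose_monom by (rule regroup)
    qed simp
  qed simp
qed

end

section \<open>Residue sums of rational functions that are small at infinity\<close>

text \<open>A shifted factorial of negative index is the reciprocal of a polynomial; multiplying by that
polynomial leaves \<open>1\<close>, the shifted factorial of the truncated index.\<close>

lemma qpoch_nat_part:
  assumes "\<And>k::int. c * q powi k \<noteq> 1"
  shows "qpoch c q (int (nat N)) = qpoch c q N * (\<Prod>k=1..nat (- N). 1 - c * q powi (- int k))"
proof (cases "N \<ge> 0")
  case False
  have nz: "1 - c * q powi (- int k) \<noteq> 0" for k using assms[of "- int k"] by simp
  have "qpoch c q N = (\<Prod>k=1..nat (- N). 1 / (1 - c * q powi (- int k)))"
    using False by (simp add: qpoch_def)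
  then have "qpoch c q N * (\<Prod>k=1..nat (- N). 1 - c * q powi (- int k)) = 1"
    using nz by (simp flip: prod.distrib)
  with False show ?thesis by simp
qed simp

context residue_data
begin

definition index_sum :: int where
  "index_sum = (\<Sum>l=1..r. m l) - (\<Sum>l=1..r. n l)"

definition A_over_B :: complex where
  "A_over_B = (\<Prod>l=1..r. A l / B l)"

definition pole_set :: "int \<Rightarrow> (nat \<times> nat) set" where
  "pole_set j = (SIGMA i:{1..r}. {..<poles j i})"

lemma finite_pole_set: "finite (pole_set j)"
  by (simp add: pole_set_def)

lemma inj_on_node: "inj_on (\<lambda>(i, k). node i k) (pole_set j)"
proof (rule inj_onI, clarify)
  fix i k l k'
  assume z: "(i, k) \<in> pole_set j" "(l, k') \<in> pole_set j" and e: "node i k = node l k'"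
  then have il: "i \<in> {1..r}" "l \<in> {1..r}" by (auto simp: pole_set_def)
  show "i = l \<and> k = k'"
  proof (cases "i = l")
    case True
    with e A_nonzero[OF il(1)] q_nonzero have "q ^ k = q ^ k'" by (simp add: node_def)
    then have "norm q ^ k = norm q ^ k'" by (simp flip: norm_power)
    then have "k = k'"
      using power_strict_decreasing[of _ _ "norm q"] q_nonzero q_lt_1
      by (metis less_irrefl linorder_neqE_nat zero_less_norm_iff)
    with True show ?thesis by simp
  next
    case False
    have "A i / A l * q powi (int k' - int k) = 1"
      using e A_nonzero[OF il(2)] q_nonzero by (simp add: node_def power_int_diff field_simps)
    with A_generic[OF il False] show ?thesis by blast
  qed
qed

lemma prod_own_nodes:
  assumes "i \<in> {1..r}" and "k < poles j i"
  shows "(\<Prod>k'\<in>{..<poles j i} - {k}. 1 - node i k / node i k')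
    = qpoch (1 / q ^ k) q (int k) * qpoch q q (j + n i - int k)"
proof -
  define d where "d = poles j i - Suc k"
  have K: "poles j i = Suc k + d" and d: "j + n i - int k = int d"
    using assms(2) by (auto simp: d_def poles_def)
  have split: "{..<poles j i} - {k} = {..<k} \<union> (\<lambda>u. Suc k + u) ` {..<d}"
  proof -
    have "x \<in> (\<lambda>u. Suc k + u) ` {..<d}" if "k < x" "x < Suc k + d" for x
      using that by (intro image_eqI[of _ _ "x - Suc k"]) auto
    then have "x \<in> {..<Suc k + d} - {k} \<longleftrightarrow> x \<in> {..<k} \<union> (\<lambda>u. Suc k + u) ` {..<d}" for x
      by (cases x k rule: linorder_cases) auto
    then show ?thesis unfolding K by blast
  qed
  have "(\<Prod>k'\<in>{..<poles j i} - {k}. 1 - node i k / node i k')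
    = (\<Prod>k'<k. 1 - node i k / node i k') * (\<Prod>k'\<in>(\<lambda>u. Suc k + u) ` {..<d}. 1 - node i k / node i k')"
    unfolding split by (rule prod.union_disjoint) auto
  also have "(\<Prod>k'<k. 1 - node i k / node i k') = qpoch (1 / q ^ k) q (int k)"
    unfolding qpoch_nat using A_nonzero[OF assms(1)] by (simp add: node_def)
  also have "(\<Prod>k'\<in>(\<lambda>u. Suc k + u) ` {..<d}. 1 - node i k / node i k') = qpoch q q (int d)"
    unfolding qpoch_nat using A_nonzero[OF assms(1)] q_nonzero
    by (subst prod.reindex) (auto simp: inj_on_def node_def power_add)
  finally show ?thesis unfolding d .
qed

text \<open>The indices \<open>l\<close> with \<open>n\<^sub>l + j + 1 < 0\<close> have no poles, and their shifted factorials contribute a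
polynomial to the numerator of \<open>g\<^sub>j\<close> instead; this polynomial is the additional product.\<close>

lemma prod_other_nodes:
  assumes "i \<in> {1..r}" and "k < poles j i"
  shows "(\<Prod>z\<in>pole_set j - {(i, k)}. 1 - node i k / (case z of (l, k') \<Rightarrow> node l k'))
    = punctured_denom j i k * (\<Prod>l=1..r. \<Prod>u=1..nat (- (n l + j + 1)). 1 - node i k / A l * q powi (- int u))"
proof -
  let ?f = "\<lambda>l k'. 1 - node i k / node l k'"
  let ?neg = "\<lambda>l. \<Prod>u=1..nat (- (n l + j + 1)). 1 - node i k / A l * q powi (- int u)"
  have split: "pole_set j - {(i, k)}
      = (SIGMA l:{1..r} - {i}. {..<poles j l}) \<union> {i} \<times> ({..<poles j i} - {k})"
    using assms by (auto simp: pole_set_def)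
  have "(\<Prod>z\<in>pole_set j - {(i, k)}. 1 - node i k / (case z of (l, k') \<Rightarrow> node l k'))
      = (\<Prod>(l, k')\<in>pole_set j - {(i, k)}. ?f l k')"
    by (simp add: case_prod_unfold)
  also have "\<dots> = (\<Prod>(l, k')\<in>(SIGMA l:{1..r} - {i}. {..<poles j l}). ?f l k')
      * (\<Prod>(l, k')\<in>{i} \<times> ({..<poles j i} - {k}). ?f l k')"
    unfolding split by (intro prod.union_disjoint) auto
  also have "(\<Prod>(l, k')\<in>{i} \<times> ({..<poles j i} - {k}). ?f l k')
      = qpoch (1 / q ^ k) q (int k) * qpoch q q (j + n i - int k)"
    using prod_own_nodes[OF assms] by (simp add: prod.cartesian_product[symmetric])
  also have "(\<Prod>(l, k')\<in>(SIGMA l:{1..r} - {i}. {..<poles j l}). ?f l k')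
      = (\<Prod>l\<in>{1..r} - {i}. \<Prod>k'<poles j l. ?f l k')"
    by (rule prod.Sigma[symmetric]) auto
  also have "\<dots> = (\<Prod>l\<in>{1..r} - {i}. qpoch (node i k / A l) q (n l + j + 1) * ?neg l)"
  proof (rule prod.cong)
    fix l assume l: "l \<in> {1..r} - {i}"
    have "(\<Prod>k'<poles j l. ?f l k') = qpoch (node i k / A l) q (int (poles j l))"
      unfolding qpoch_nat using l A_nonzero q_nonzero by (simp add: node_def)
    also have "int (poles j l) = int (nat (n l + j + 1))" by (simp add: poles_def algebra_simps)
    also have "qpoch (node i k / A l) q (int (nat (n l + j + 1)))
        = qpoch (node i k / A l) q (n l + j + 1) * ?neg l"
      using l assms(1) node_generic by (intro qpoch_nat_part) auto
    finally show "(\<Prod>k'<poles j l. ?f l k') = qpoch (node i k / A l) q (n l + j + 1) * ?neg l" .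
  qed simp
  also have "\<dots> = (\<Prod>l\<in>{1..r} - {i}. qpoch (node i k / A l) q (n l + j + 1)) * (\<Prod>l\<in>{1..r} - {i}. ?neg l)"
    by (rule prod.distrib)
  also have "(\<Prod>l\<in>{1..r} - {i}. ?neg l) = (\<Prod>l=1..r. ?neg l)"
  proof -
    have "?neg i = 1" using assms(2) by (simp add: poles_def)
    then show ?thesis using assms(1) by (subst (2) prod.remove[of _ i]) auto
  qed
  finally show ?thesis unfolding punctured_denom_def by (simp add: mult_ac)
qed

text \<open>The order \<open>t\<close> of \<open>\<Phi>\<close> at \<open>0\<close> removes the pole of \<open>x^(-t)\<close>, so that the numerator is a
polynomial \<open>T\<close>. The bound on the degree of \<open>\<Phi>\<close> is the one for which \<open>T\<close> has degree at most
the number of poles minus two, where interpolation applies.\<close>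

lemma residue_sum_vanishes:
  assumes nonneg: "\<And>l. l \<in> {1..r} \<Longrightarrow> m l + j - int s \<ge> 0"
    and dvd: "[:0, 1:] ^ nat t dvd \<Phi>"
    and deg: "int (degree \<Phi>) + (index_sum - int r - t + 2) \<le> int (r * s)"
  shows "residue_sum s j \<Phi> = 0"
proof (cases "\<Phi> = 0")
  case True
  then show ?thesis by (simp add: residue_sum_def)
next
  case False
  \<comment> \<open>\<open>\<Theta>\<close> is the polynomial \<open>x^(-t) \<Phi>(q^j x)\<close>.\<close>
  have "\<exists>\<Theta>. (\<forall>x. x \<noteq> 0 \<longrightarrow> poly \<Theta> x = x powi (- t) * poly \<Phi> (q powi j * x))
      \<and> int (degree \<Theta>) \<le> int (degree \<Phi>) - t"
  proof (cases "t \<ge> 0")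
    case True
    obtain \<Psi> where \<Psi>: "\<Phi> = [:0, 1:] ^ nat t * \<Psi>" using dvd by blast
    with False have "\<Psi> \<noteq> 0" by auto
    then have dg: "degree \<Phi> = nat t + degree \<Psi>"
      unfolding \<Psi> by (subst degree_mult_eq) (auto simp: degree_power_eq)
    let ?\<Theta> = "smult ((q powi j) ^ nat t) (pcompose \<Psi> (monom (q powi j) 1))"
    have "poly ?\<Theta> x = x powi (- t) * poly \<Phi> (q powi j * x)" if "x \<noteq> 0" for x
    proof -
      have "x powi (- t) * x ^ nat t = 1"
        using True that by (simp add: power_int_minus flip: power_int_of_nat)
      then have "x powi (- t) * (q powi j * x) ^ nat t = (q powi j) ^ nat t"
        by (simp add: power_mult_distrib mult.left_commute)
      then show ?thesis unfolding \<Psi> poly_smult poly_pcompose_monom poly_mult poly_power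
        by (simp add: mult.assoc[symmetric])
    qed
    moreover have "int (degree ?\<Theta>) \<le> int (degree \<Phi>) - t"
    proof -
      have "degree ?\<Theta> \<le> degree \<Psi> * degree (monom (q powi j) 1)"
        by (rule order.trans[OF degree_smult_le]) (simp add: degree_pcompose)
      also have "\<dots> \<le> degree \<Psi> * 1" by (intro mult_le_mono degree_monom_le order.refl)
      finally show ?thesis using dg True by simp
    qed
    ultimately show ?thesis by blast
  next
    case neg: False
    let ?\<Theta> = "[:0, 1:] ^ nat (- t) * pcompose \<Phi> (monom (q powi j) 1)"
    have "poly ?\<Theta> x = x powi (- t) * poly \<Phi> (q powi j * x)" for x
    proof -
      have "x ^ nat (- t) = x powi (- t)" using neg by (simp flip: power_int_of_nat)
      then show ?thesis by (simp only: poly_mult poly_power poly_pcompose_monom) simp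
    qed
    moreover have "int (degree ?\<Theta>) \<le> int (degree \<Phi>) - t"
    proof -
      have "degree ?\<Theta> \<le> degree ([:0, 1::complex:] ^ nat (- t)) + degree (pcompose \<Phi> (monom (q powi j) 1))"
        by (rule degree_mult_le)
      also have "\<dots> \<le> nat (- t) + degree \<Phi> * degree (monom (q powi j) 1)"
        by (simp add: degree_power_eq degree_pcompose)
      also have "\<dots> \<le> nat (- t) + degree \<Phi> * 1" by (intro add_mono mult_le_mono degree_monom_le order.refl)
      finally show ?thesis using neg by simp
    qed
    ultimately show ?thesis by blast
  qed
  then obtain \<Theta> where poly_\<Theta>: "\<And>x. x \<noteq> 0 \<Longrightarrow> poly \<Theta> x = x powi (- t) * poly \<Phi> (q powi j * x)"
    and deg_\<Theta>: "int (degree \<Theta>) \<le> int (degree \<Phi>) - t" by blast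
  define Num where "Num = (\<Prod>l=1..r. qpoch_poly (q / B l) q (nat (m l + j - int s)))"
  define Neg where "Neg = (\<Prod>l=1..r. \<Prod>u=1..nat (- (n l + j + 1)). [:1, - (q powi (- int u) / A l):])"
  define T where "T = \<Theta> * Num * Neg"
  have "degree Num \<le> (\<Sum>l=1..r. nat (m l + j - int s))"
    unfolding Num_def
    by (rule order.trans[OF degree_prod_sum_le[unfolded comp_def]]) (auto intro: sum_mono degree_qpoch_poly)
  then have "int (degree Num) \<le> int (\<Sum>l=1..r. nat (m l + j - int s))" by (simp only: of_nat_le_iff)
  also have "\<dots> = (\<Sum>l=1..r. m l + j - int s)" using nonneg by simp
  finally have deg_Num: "int (degree Num) \<le> (\<Sum>l=1..r. m l) + int r * j - int r * int s"
    by (simp add: sum.distrib sum_subtractf)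
  have "degree Neg \<le> (\<Sum>l=1..r. nat (- (n l + j + 1)))"
    unfolding Neg_def
  proof (rule order.trans[OF degree_prod_sum_le[unfolded comp_def]], simp, rule sum_mono)
    fix l
    have "degree (\<Prod>u=1..nat (- (n l + j + 1)). [:1, - (q powi (- int u) / A l):])
        \<le> (\<Sum>u=1..nat (- (n l + j + 1)). degree [:1, - (q powi (- int u) / A l):])"
      by (rule degree_prod_sum_le[unfolded comp_def]) simp
    also have "\<dots> \<le> (\<Sum>u=1..nat (- (n l + j + 1)). 1)" by (intro sum_mono) auto
    finally show "degree (\<Prod>u=1..nat (- (n l + j + 1)). [:1, - (q powi (- int u) / A l):])
      \<le> nat (- (n l + j + 1))" by simp
  qed
  then have deg_Neg: "int (degree Neg) \<le> (\<Sum>l=1..r. int (nat (- (n l + j + 1))))"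
    by (simp only: of_nat_sum[symmetric] of_nat_le_iff)
  \<comment> \<open>The truncated parts \<open>nat (- (n l + j + 1))\<close> enter the number of poles and the degree of
    \<open>Neg\<close> alike and cancel in the comparison.\<close>
  have "int (card (pole_set j)) = (\<Sum>l=1..r. int (poles j l))"
    by (simp add: pole_set_def)
  also have "\<dots> = (\<Sum>l=1..r. n l + j + 1 + int (nat (- (n l + j + 1))))"
    by (intro sum.cong) (auto simp: poles_def)
  finally have card: "int (card (pole_set j))
      = (\<Sum>l=1..r. n l) + int r * j + int r + (\<Sum>l=1..r. int (nat (- (n l + j + 1))))"
    by (simp add: sum.distrib)
  have "degree T \<le> degree \<Theta> + degree Num + degree Neg"
    unfolding T_def using degree_mult_le[of "\<Theta> * Num" Neg] degree_mult_le[of \<Theta> Num] by linarith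
  then have "int (degree T) + 2 \<le> int (card (pole_set j))"
    using deg deg_\<Theta> deg_Num deg_Neg card by (simp add: index_sum_def)
  then have "degree T + 2 \<le> card (pole_set j)" by linarith
  have "residue_sum s j \<Phi> = (\<Sum>(i, k)\<in>pole_set j.
     node i k powi (1 - t) * numer (j - int s) (node i k) * poly \<Phi> (q powi j * node i k) / punctured_denom j i k)"
    unfolding residue_sum_def pole_set_def by (rule sum.Sigma) auto
  also have "\<dots> = (\<Sum>z\<in>pole_set j. (case z of (i, k) \<Rightarrow> node i k) * poly T (case z of (i, k) \<Rightarrow> node i k)
      / (\<Prod>z'\<in>pole_set j - {z}. 1 - (case z of (i, k) \<Rightarrow> node i k) / (case z' of (l, k') \<Rightarrow> node l k')))"
  proof (rule sum.cong, simp, clarify)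
    fix i k assume "(i, k) \<in> pole_set j"
    then have i: "i \<in> {1..r}" and k: "k < poles j i" by (auto simp: pole_set_def)
    let ?x = "node i k"
    let ?neg = "\<Prod>l=1..r. \<Prod>u=1..nat (- (n l + j + 1)). 1 - ?x / A l * q powi (- int u)"
    have x: "?x \<noteq> 0" by (rule node_nonzero[OF i])
    have neg: "poly Neg ?x = ?neg"
      unfolding Neg_def poly_prod by (simp add: algebra_simps)
    have neg_nz: "?neg \<noteq> 0"
    proof -
      have "1 - ?x / A l * q powi (- int u) \<noteq> 0" if "l \<in> {1..r}" "u \<in> {1..nat (- (n l + j + 1))}" for l u
      proof -
        have "l \<noteq> i" using that k by (auto simp: poles_def)
        with node_generic[OF i that(1), of k "- int u"] show ?thesis by auto
      qed
      then show ?thesis by (metis (no_types, lifting) finite_atLeastAtMost prod_zero_iff)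
    qed
    have num: "poly Num ?x = numer (j - int s) ?x"
      unfolding Num_def poly_prod poly_qpoch_poly numer_def using nonneg
      by (intro prod.cong) (auto simp: algebra_simps)
    have "?x powi (1 - t) = ?x * ?x powi (- t)"
      using x by (simp add: power_int_diff power_int_minus divide_inverse)
    then have "?x powi (1 - t) * numer (j - int s) ?x * poly \<Phi> (q powi j * ?x)
        = ?x * (poly \<Theta> ?x * poly Num ?x)"
      by (simp add: poly_\<Theta>[OF x] num)
    moreover have cancel: "a / d = x * (b * c * w) / (d * w)"
      if "a = x * (b * c)" and "w \<noteq> 0" for a b c d w x :: complex
      using that by simp
    ultimately show "?x powi (1 - t) * numer (j - int s) ?x * poly \<Phi> (q powi j * ?x) / punctured_denom j i k
      = ?x * poly T ?x / (\<Prod>z'\<in>pole_set j - {(i, k)}. 1 - ?x / (case z' of (l, k') \<Rightarrow> node l k'))"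
      unfolding prod_other_nodes[OF i k] T_def poly_mult neg using neg_nz by (intro cancel)
  qed
  also have "\<dots> = 0"
    using finite_pole_set inj_on_node \<open>degree T + 2 \<le> card (pole_set j)\<close>
    by (intro sum_residues_zero) (auto simp: pole_set_def node_nonzero)
  finally show ?thesis .
qed

end

section \<open>An operator that annihilates the coefficients\<close>

lemma pcompose_monom_X_power:
  fixes c :: complex
  shows "pcompose ([:0, 1:] ^ v * P) (monom c 1) = [:0, 1:] ^ v * smult (c ^ v) (pcompose P (monom c 1))"
proof (induction v)
  case (Suc v)
  have "pcompose [:0, 1:] (monom c 1) = smult c [:0, 1:]"
    by (simp add: pcompose_pCons monom_altdef)
  with Suc show ?case
    by (simp only: power_Suc mult.assoc pcompose_mult[of "[:0, 1:]"]) (simp add: mult_ac)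
qed simp

context residue_data
begin

definition Warg :: complex where
  "Warg = q powi (t + int r - 1) * A_over_B"

definition zero_order :: nat where
  "zero_order = nat t"

text \<open>This is \<open>p + 1\<close>: without any step, \<open>x^(-t) g\<^sub>j(x)\<close> behaves at infinity like \<open>x^(p-1)\<close> if \<open>p \<ge> 0\<close>,
and there is no residue at infinity once it is \<open>O(x^(-2))\<close>.\<close>

definition degree_drop :: nat where
  "degree_drop = nat (index_sum - int r - t + 2)"

text \<open>The ratio \<open>c\<close> of the factor \<open>1 - c S\<close> applied at step \<open>s\<close>: first \<open>1, q, \<dots>, q^(t-1)\<close>, which
raise the order at \<open>0\<close>, then \<open>W q^p, \<dots>, W q, W\<close>, which lower the degree. The second family
is taken in descending order because the coefficient to be cancelled at infinity is then
the leading one at each step.\<close>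

definition step_ratio :: "nat \<Rightarrow> complex" where
  "step_ratio s = (if s < zero_order then q ^ s else Warg * q ^ (degree_drop - 1 - (s - zero_order)))"

primrec step_poly :: "nat \<Rightarrow> complex poly" where
  "step_poly 0 = 1"
| "step_poly (Suc s) = next_poly s (step_ratio s) (step_poly s)"

lemma degree_numer_step: "degree numer_step \<le> r" and degree_denom_step: "degree denom_step \<le> r"
proof -
  have *: "degree (\<Prod>l=1..r. [:1, - f l:]) \<le> r" for f :: "nat \<Rightarrow> complex"
  proof -
    have "degree (\<Prod>l=1..r. [:1, - f l:]) \<le> (\<Sum>l=1..r. degree [:1, - f l:])"
      by (rule degree_prod_sum_le[unfolded comp_def]) simp
    also have "\<dots> \<le> (\<Sum>l=1..r. 1)" by (intro sum_mono) auto
    finally show ?thesis by simp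
  qed
  show "degree numer_step \<le> r" "degree denom_step \<le> r"
    unfolding numer_step_def denom_step_def by (rule *)+
qed

lemma coeff_prod_linear_top:
  fixes f :: "nat \<Rightarrow> complex"
  assumes "\<And>l. l \<in> {1..N} \<Longrightarrow> f l \<noteq> 0"
  shows "coeff (\<Prod>l=1..N. [:1, - f l:]) N = (\<Prod>l=1..N. - f l)"
proof -
  have "degree (\<Prod>l=1..N. [:1, - f l:]) = (\<Sum>l=1..N. degree [:1, - f l:])"
    using assms by (intro degree_prod_sum_eq) auto
  also have "\<dots> = (\<Sum>l=1..N. 1)" using assms by (intro sum.cong) auto
  finally have "degree (\<Prod>l=1..N. [:1, - f l:]) = N" by simp
  then have "coeff (\<Prod>l=1..N. [:1, - f l:]) N = lead_coeff (\<Prod>l=1..N. [:1, - f l:])" by simp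
  also have "\<dots> = (\<Prod>l=1..N. lead_coeff [:1, - f l:])" by (rule lead_coeff_prod)
  also have "\<dots> = (\<Prod>l=1..N. - f l)" using assms by (intro prod.cong) auto
  finally show ?thesis .
qed

text \<open>The behaviour of \<open>g\<^sub>j / g\<^sub>j\<^sub>-\<^sub>1\<close> at infinity, from which the ratios \<open>W q^s\<close> arise.\<close>

lemma top_coeff_ratio:
  "coeff numer_step r = coeff denom_step r * (q powi index_sum * A_over_B)"
proof -
  have "coeff numer_step r = (\<Prod>l=1..r. - (q powi m l / B l))"
    unfolding numer_step_def using q_nonzero B_nonzero by (intro coeff_prod_linear_top) auto
  also have "\<dots> = (\<Prod>l=1..r. - (q powi n l / A l) * (q powi (m l - n l) * (A l / B l)))"
    using q_nonzero A_nonzero by (intro prod.cong) (auto simp: power_int_diff field_simps)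
  also have "\<dots> = (\<Prod>l=1..r. - (q powi n l / A l)) * ((\<Prod>l=1..r. q powi (m l - n l)) * A_over_B)"
    unfolding A_over_B_def by (simp only: prod.distrib)
  also have "(\<Prod>l=1..r. - (q powi n l / A l)) = coeff denom_step r"
    unfolding denom_step_def using q_nonzero A_nonzero by (intro coeff_prod_linear_top[symmetric]) auto
  also have "(\<Prod>l=1..r. q powi (m l - n l)) = q powi index_sum"
  proof -
    have "(\<Prod>l\<in>S. q powi (m l - n l)) = q powi (\<Sum>l\<in>S. m l - n l)" if "finite S" for S
      using that q_nonzero by (induction S rule: finite_induct) (auto simp: power_int_add)
    then show ?thesis by (simp add: index_sum_def sum_subtractf)
  qed
  finally show ?thesis .
qed

lemma poly_steps_0: "poly numer_step 0 = 1" "poly denom_step 0 = 1"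
  by (simp_all add: numer_step_def denom_step_def poly_prod)

lemma next_poly_keeps_order:
  assumes "[:0, 1:] ^ v dvd \<Phi>"
  shows "[:0, 1:] ^ v dvd next_poly s c \<Phi>"
proof -
  obtain \<Psi> where \<Psi>: "\<Phi> = [:0, 1:] ^ v * \<Psi>" using assms by blast
  have "pcompose \<Phi> (monom (1 / q) 1) = [:0, 1:] ^ v * smult ((1 / q) ^ v) (pcompose \<Psi> (monom (1 / q) 1))"
    unfolding \<Psi> by (rule pcompose_monom_X_power)
  then have "[:0, 1:] ^ v dvd pcompose \<Phi> (monom (1 / q) 1)" by (metis dvd_triv_left)
  with assms show ?thesis unfolding next_poly_def by (intro dvd_diff dvd_mult dvd_smult)
qed

text \<open>Dividing \<open>\<Phi>(y)\<close> and \<open>\<Phi>(y/q)\<close> by \<open>y^s\<close> leaves quotients whose constant terms differ by the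
factor \<open>q^(-s)\<close>. The choice \<open>c = q^s\<close> makes the two constant terms cancel, since
\<open>U(0) = V(0) = 1\<close>.\<close>

lemma next_poly_raises_order:
  assumes "[:0, 1:] ^ s dvd \<Phi>"
  shows "[:0, 1:] ^ Suc s dvd next_poly s (q ^ s) \<Phi>"
proof -
  obtain \<Psi> where \<Psi>: "\<Phi> = [:0, 1:] ^ s * \<Psi>" using assms by blast
  let ?X = "pcompose numer_step (monom (q powi (- int s)) 1) * \<Psi> - denom_step * pcompose \<Psi> (monom (1 / q) 1)"
  have "pcompose \<Phi> (monom (1 / q) 1) = [:0, 1:] ^ s * smult ((1 / q) ^ s) (pcompose \<Psi> (monom (1 / q) 1))"
    unfolding \<Psi> by (rule pcompose_monom_X_power)
  then have "smult (q ^ s) (denom_step * pcompose \<Phi> (monom (1 / q) 1))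
      = [:0, 1:] ^ s * (denom_step * pcompose \<Psi> (monom (1 / q) 1))"
    using q_nonzero by (simp add: power_divide mult_ac)
  then have "next_poly s (q ^ s) \<Phi> = [:0, 1:] ^ s * ?X"
    unfolding next_poly_def by (simp add: \<Psi> algebra_simps)
  moreover have "poly ?X 0 = 0"
    unfolding poly_diff poly_mult poly_pcompose_monom mult_zero_right poly_steps_0 by simp
  then have "[:0, 1:] dvd ?X" using poly_eq_0_iff_dvd[of ?X 0] by simp
  ultimately show ?thesis by (simp only: power_Suc2) (rule mult_dvd_mono, simp_all)
qed

lemma degree_pcompose_monom_le: "degree (pcompose P (monom (c::complex) 1)) \<le> degree P"
proof -
  have "degree (pcompose P (monom c 1)) \<le> degree P * degree (monom c 1)" by (rule degree_pcompose_le)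
  also have "\<dots> \<le> degree P * 1" by (intro mult_le_mono degree_monom_le order.refl)
  finally show ?thesis by simp
qed

lemma degree_next_poly_le:
  assumes "degree \<Phi> \<le> D"
  shows "degree (next_poly s c \<Phi>) \<le> r + D"
proof -
  have "degree (pcompose numer_step (monom (q powi (- int s)) 1) * \<Phi>) \<le> r + D"
    using degree_mult_le[of "pcompose numer_step (monom (q powi (- int s)) 1)" \<Phi>]
      degree_pcompose_monom_le[of numer_step "q powi (- int s)"] degree_numer_step assms by linarith
  moreover have "degree (smult c (denom_step * pcompose \<Phi> (monom (1 / q) 1))) \<le> r + D"
    using degree_smult_le[of c "denom_step * pcompose \<Phi> (monom (1 / q) 1)"]
      degree_mult_le[of denom_step "pcompose \<Phi> (monom (1 / q) 1)"]
      degree_pcompose_monom_le[of \<Phi> "1 / q"] degree_denom_step assms by linarith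
  ultimately show ?thesis unfolding next_poly_def by (rule degree_diff_le)
qed

text \<open>With \<open>D = r s - e\<close>, the coefficients of \<open>y^(r+D)\<close> in \<open>U(q^(-s) y) \<Phi>(y)\<close> and in \<open>V(y) \<Phi>(y/q)\<close>
have the ratio \<open>q^(D - r s) q^(M-N) \<Prod>\<^sub>l A\<^sub>l/B\<^sub>l\<close> (\<open>top_coeff_ratio\<close>), where \<open>M\<close> and \<open>N\<close> are the sums
of the \<open>m\<^sub>l\<close> and of the \<open>n\<^sub>l\<close>. This ratio is the \<open>c\<close> of the statement, so the top term cancels.\<close>

lemma next_poly_lowers_degree:
  assumes "degree \<Phi> + e \<le> r * s"
  shows "degree (next_poly s (q powi (index_sum - int e) * A_over_B) \<Phi>) + Suc e \<le> r * Suc s"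
proof -
  define D where "D = r * s - e"
  have D: "int D = int r * int s - int e" and dD: "degree \<Phi> \<le> D"
    using assms by (auto simp: D_def of_nat_diff)
  let ?c = "q powi (index_sum - int e) * A_over_B"
  let ?U = "pcompose numer_step (monom (q powi (- int s)) 1)"
  let ?F = "pcompose \<Phi> (monom (1 / q) 1)"
  have "coeff (next_poly s ?c \<Phi>) (r + D) = coeff ?U r * coeff \<Phi> D - ?c * (coeff denom_step r * coeff ?F D)"
    unfolding next_poly_def coeff_diff coeff_smult
    using degree_pcompose_monom_le[of numer_step "q powi (- int s)"] degree_numer_step
      degree_pcompose_monom_le[of \<Phi> "1 / q"] degree_denom_step dD
    by (subst (1 2) coeff_mult_top) auto
  also have "coeff ?U r = (q powi (- int s)) ^ r * coeff numer_step r" by simp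
  also have "coeff ?F D = (1 / q) ^ D * coeff \<Phi> D" by simp
  also have "(q powi (- int s)) ^ r * coeff numer_step r * coeff \<Phi> D
      - ?c * (coeff denom_step r * ((1 / q) ^ D * coeff \<Phi> D)) = 0"
  proof -
    have "(1 / q) ^ D = q powi (- int D)"
      by (simp add: power_int_minus power_divide inverse_eq_divide)
    then have "q powi (index_sum - int e) * (1 / q) ^ D = q powi (index_sum - int r * int s)"
      using q_nonzero by (simp add: D flip: power_int_add)
    moreover have "(q powi (- int s)) ^ r = q powi (- int s * int r)"
      by (simp only: power_int_mult power_int_of_nat)
    then have "(q powi (- int s)) ^ r * q powi index_sum = q powi (index_sum - int r * int s)"
      using q_nonzero by (simp add: algebra_simps flip: power_int_add)
    ultimately have "(q powi (- int s)) ^ r * q powi index_sum = q powi (index_sum - int e) * (1 / q) ^ D" by simp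
    then have "(q powi (- int s)) ^ r * q powi index_sum * (coeff denom_step r * A_over_B * coeff \<Phi> D)
        = q powi (index_sum - int e) * (1 / q) ^ D * (coeff denom_step r * A_over_B * coeff \<Phi> D)" by simp
    then show ?thesis unfolding top_coeff_ratio by (simp add: mult_ac)
  qed
  finally have z: "coeff (next_poly s ?c \<Phi>) (r + D) = 0" .
  have "degree (next_poly s ?c \<Phi>) < r + D"
  proof (rule ccontr)
    assume "\<not> degree (next_poly s ?c \<Phi>) < r + D"
    with degree_next_poly_le[OF dD] have "degree (next_poly s ?c \<Phi>) = r + D" by (metis le_neq_implies_less)
    with z have "next_poly s ?c \<Phi> = 0" by (metis leading_coeff_0_iff)
    with \<open>degree (next_poly s ?c \<Phi>) = r + D\<close> r_pos show False by simp
  qed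
  moreover have "r * Suc s = r + D + e" using assms by (simp add: D_def)
  ultimately show ?thesis by simp
qed

lemma step_poly_raising: "s \<le> zero_order \<Longrightarrow> [:0, 1:] ^ s dvd step_poly s \<and> degree (step_poly s) \<le> r * s"
proof (induction s)
  case (Suc s)
  then have "step_ratio s = q ^ s" by (simp add: step_ratio_def)
  with Suc next_poly_raises_order[of s "step_poly s"] degree_next_poly_le[of "step_poly s" "r * s" s "q ^ s"]
  show ?case by simp
qed simp

lemma step_poly_lowering:
  "e \<le> degree_drop \<Longrightarrow> [:0, 1:] ^ zero_order dvd step_poly (zero_order + e)
     \<and> degree (step_poly (zero_order + e)) + e \<le> r * (zero_order + e)"
proof (induction e)
  case 0
  then show ?case using step_poly_raising[of zero_order] by simp
next
  case (Suc e)
  have "step_ratio (zero_order + e) = q powi (index_sum - int e) * A_over_B"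
  proof -
    have e: "index_sum - int e = t + int r - 1 + int (degree_drop - 1 - e)"
      using Suc.prems unfolding degree_drop_def by linarith
    show ?thesis unfolding e step_ratio_def Warg_def using q_nonzero by (simp add: power_int_add)
  qed
  then show ?case
    using Suc next_poly_keeps_order next_poly_lowers_degree[of "step_poly (zero_order + e)" e "zero_order + e"]
    by simp
qed

text \<open>The coefficient of \<open>z^k\<close> in the \<open>i\<close>-th series on the left-hand side of the identity.\<close>

definition phi_coeff :: "nat \<Rightarrow> nat \<Rightarrow> complex" where
  "phi_coeff i k = (\<Prod>l=1..r. qpoch (B l / A i) q (int k))
     / (qpoch q q (int k) * (\<Prod>l\<in>{1..r} - {i}. qpoch (q * A l / A i) q (int k)))"

definition tail_coeff :: "nat \<Rightarrow> int \<Rightarrow> complex" where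
  "tail_coeff i s = (\<Prod>l=1..r. qpoch (q * A i / B l) q (m l + s))
     / (qpoch q q (s + n i) * (\<Prod>l\<in>{1..r} - {i}. qpoch (A i / A l) q (n l + s + 1)))"

text \<open>The sequence \<open>\<alpha>\<close>, written as a sum of convolutions.\<close>

definition cauchy_coeff :: "int \<Rightarrow> complex" where
  "cauchy_coeff j = (\<Sum>i=1..r. A i powi (1 - t)
     * (\<Sum>k<poles j i. phi_coeff i k * Warg ^ k * tail_coeff i (j - int k)))"

lemma numer_defined_ge:
  "i \<in> {1..r} \<Longrightarrow> l \<in> {1..r} \<Longrightarrow> s + n i \<ge> 0 \<Longrightarrow> qpoch_defined (q * A i / B l) q (m l + s)"
  by (rule qpoch_defined_mono[OF numer_defined]) auto

text \<open>At \<open>x = A\<^sub>i q^(-k)\<close> each shifted factorial of \<open>g\<^sub>j\<close> splits after its first \<open>k\<close> factors. These,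
read backwards, form the coefficient of the series together with the power \<open>W^k\<close>; the
remaining factors start at \<open>q^0\<close> again and form \<open>tail_coeff\<close>.\<close>

lemma residue_eq_product:
  assumes i: "i \<in> {1..r}" and k: "k < poles j i"
  shows "node i k powi (1 - t) * numer j (node i k) / punctured_denom j i k
    = A i powi (1 - t) * (phi_coeff i k * Warg ^ k * tail_coeff i (j - int k))"
proof -
  let ?e = "rev_factor q k"
  let ?R = "{1..r} - {i}"
  note nz = q_nonzero A_nonzero[OF i] rev_factor_nonzero[OF q_nonzero, of k]
  have num: "qpoch (q * node i k / B l) q (m l + j)
      = (A i / B l) ^ k * ?e * (qpoch (B l / A i) q (int k) * qpoch (q * A i / B l) q (m l + (j - int k)))"
    if l: "l \<in> {1..r}" for l
  proof -
    have c: "q * node i k / B l * q ^ k = q * A i / B l"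
      using q_nonzero B_nonzero[OF l] by (simp add: node_def field_simps)
    have d: "qpoch_defined (q * A i / B l) q (m l + (j - int k))"
      using k by (intro numer_defined_ge[OF i l]) (auto simp: poles_def)
    have "m l + j = int k + (m l + (j - int k))" by simp
    then have "qpoch (q * node i k / B l) q (m l + j)
        = qpoch (q * node i k / B l) q (int k) * qpoch (q * A i / B l) q (m l + (j - int k))"
      using qpoch_split[OF q_nonzero, of "q * node i k / B l" k "m l + (j - int k)"] d unfolding c by metis
    also have "qpoch (q * node i k / B l) q (int k) = qpoch (A i / B l * q powi (1 - int k)) q (int k)"
      using q_nonzero by (simp add: node_def power_int_diff mult_ac)
    also have "\<dots> = (A i / B l) ^ k * ?e * qpoch (B l / A i) q (int k)"
      using qpoch_reverse[OF q_nonzero, of "A i / B l" k] nz B_nonzero[OF l] by simp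
    finally show ?thesis by (simp add: mult_ac)
  qed
  have den: "qpoch (node i k / A l) q (n l + j + 1)
      = (A i / (q * A l)) ^ k * ?e * (qpoch (q * A l / A i) q (int k) * qpoch (A i / A l) q (n l + (j - int k) + 1))"
    if l: "l \<in> ?R" for l
  proof -
    have c: "node i k / A l * q ^ k = A i / A l" using q_nonzero by (simp add: node_def)
    have d: "qpoch_defined (A i / A l) q (n l + (j - int k) + 1)"
      using A_generic[OF i, of l] l by (intro qpoch_defined_generic) auto
    have "n l + j + 1 = int k + (n l + (j - int k) + 1)" by simp
    then have "qpoch (node i k / A l) q (n l + j + 1)
        = qpoch (node i k / A l) q (int k) * qpoch (A i / A l) q (n l + (j - int k) + 1)"
      using qpoch_split[OF q_nonzero, of "node i k / A l" k "n l + (j - int k) + 1"] d unfolding c by metis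
    also have "qpoch (node i k / A l) q (int k) = qpoch (A i / (q * A l) * q powi (1 - int k)) q (int k)"
      using q_nonzero by (simp add: node_def power_int_diff mult_ac)
    also have "\<dots> = (A i / (q * A l)) ^ k * ?e * qpoch (q * A l / A i) q (int k)"
      using qpoch_reverse[OF q_nonzero, of "A i / (q * A l)" k] nz A_nonzero[of l] l by simp
    finally show ?thesis by (simp add: mult_ac)
  qed
  have own: "qpoch (1 / q ^ k) q (int k) = (1 / q) ^ k * ?e * qpoch q q (int k)"
    using qpoch_reverse[OF q_nonzero, of "1 / q" k] q_nonzero by (simp add: power_int_diff)
  define Pn where "Pn = (\<Prod>l=1..r. qpoch (B l / A i) q (int k)) * (\<Prod>l=1..r. qpoch (q * A i / B l) q (m l + (j - int k)))"
  define Pd where "Pd = (\<Prod>l\<in>?R. qpoch (q * A l / A i) q (int k)) * (\<Prod>l\<in>?R. qpoch (A i / A l) q (n l + (j - int k) + 1))"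
  have cR: "card ?R = r - 1" using i by simp
  have N: "numer j (node i k) = (\<Prod>l=1..r. A i / B l) ^ k * ?e ^ r * Pn"
    unfolding numer_def Pn_def
    by (subst prod.cong[OF refl num]) (simp_all add: prod.distrib prod_power_distrib)
  have D: "punctured_denom j i k = (1 / q) ^ k * ?e * qpoch q q (int k) * qpoch q q (j + n i - int k)
      * ((\<Prod>l\<in>?R. A i / (q * A l)) ^ k * ?e ^ (r - 1) * Pd)"
    unfolding punctured_denom_def own Pd_def cR[symmetric]
    by (subst prod.cong[OF refl den]) (simp_all add: prod.distrib prod_power_distrib)
  have ee: "?e ^ r = ?e * ?e ^ (r - 1)" using r_pos by (simp flip: power_Suc)
  have W: "node i k powi (1 - t) * (\<Prod>l=1..r. A i / B l) ^ k
      = A i powi (1 - t) * Warg ^ k * ((1 / q) ^ k * (\<Prod>l\<in>?R. A i / (q * A l)) ^ k)"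
  proof -
    have a: "node i k powi (1 - t) = A i powi (1 - t) * (q powi (t - 1)) ^ k"
    proof -
      have "(q ^ k) powi (1 - t) = (q powi (1 - t)) ^ k"
        by (simp only: power_int_of_nat[symmetric] power_int_mult[symmetric] mult.commute)
      moreover have "q powi (t - 1) = 1 / q powi (1 - t)"
        using q_nonzero by (simp add: power_int_diff)
      ultimately show ?thesis
        by (simp only: node_def power_int_divide_distrib power_divide power_one times_divide_eq_right mult_1_right)
    qed
    have "(\<Prod>l=1..r. A i / B l) = A_over_B * (\<Prod>l=1..r. A i / A l)"
      unfolding A_over_B_def prod.distrib[symmetric] using A_nonzero by (intro prod.cong) auto
    also have "(\<Prod>l=1..r. A i / A l) = (\<Prod>l\<in>?R. A i / A l)"
      using i nz by (subst prod.remove[of _ i]) auto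
    also have "\<dots> = (\<Prod>l\<in>?R. q * (A i / (q * A l)))"
      using q_nonzero by (intro prod.cong) auto
    also have "\<dots> = q ^ (r - 1) * (\<Prod>l\<in>?R. A i / (q * A l))"
      by (simp only: prod.distrib prod_constant cR)
    finally have b: "(\<Prod>l=1..r. A i / B l) = A_over_B * (q ^ (r - 1) * (\<Prod>l\<in>?R. A i / (q * A l)))" .
    have "q powi (t - 1) * q ^ (r - 1) = q powi (t + int r - 1) * (1 / q)"
      using q_nonzero r_pos by (simp add: power_int_add power_int_diff power_diff)
    then have c: "q powi (t - 1) * (\<Prod>l=1..r. A i / B l) = Warg * ((1 / q) * (\<Prod>l\<in>?R. A i / (q * A l)))"
    proof -
      have "x * (y * (z * w)) = (u * y) * (v * w)" if "x * z = u * v" for x y z w u v :: complex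
      proof -
        have "x * (y * (z * w)) = (x * z) * (y * w)" by (simp add: mult_ac)
        also have "\<dots> = (u * y) * (v * w)" unfolding that by (simp add: mult_ac)
        finally show ?thesis .
      qed
      from this[OF\<open>q powi (t - 1) * q ^ (r - 1) = q powi (t + int r - 1) * (1 / q)\<close>]
      show ?thesis unfolding b Warg_def .
    qed
    show ?thesis unfolding a power_mult_distrib[symmetric]
      by (simp only: mult.assoc power_mult_distrib[symmetric] c)
  qed
  have g1: "(1 / q) ^ k * (\<Prod>l\<in>?R. A i / (q * A l)) ^ k \<noteq> 0"
    using q_nonzero i A_nonzero by auto
  have "node i k powi (1 - t) * numer j (node i k) / punctured_denom j i k
      = (node i k powi (1 - t) * (\<Prod>l=1..r. A i / B l) ^ k) * (?e * ?e ^ (r - 1)) * Pn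
        / (((1 / q) ^ k * (\<Prod>l\<in>?R. A i / (q * A l)) ^ k) * (?e * ?e ^ (r - 1))
           * (qpoch q q (int k) * qpoch q q (j + n i - int k) * Pd))"
    unfolding N D ee by (simp only: mult_ac)
  also have "\<dots> = A i powi (1 - t) * Warg ^ k * (Pn / (qpoch q q (int k) * qpoch q q (j + n i - int k) * Pd))"
  proof -
    have "x * g * e * p / (g * e * d) = x * (p / d)" if "g \<noteq> 0" "e \<noteq> 0" for x g e p d :: complex
      using that by simp
    moreover have "?e * ?e ^ (r - 1) \<noteq> 0" using nz(3) by simp
    ultimately show ?thesis unfolding W using g1 by blast
  qed
  also have "Pn / (qpoch q q (int k) * qpoch q q (j + n i - int k) * Pd) = phi_coeff i k * tail_coeff i (j - int k)"
    unfolding phi_coeff_def tail_coeff_def Pn_def Pd_def by (simp add: algebra_simps)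
  finally show ?thesis by (simp add: mult_ac)
qed

lemma cauchy_coeff_eq_residue_sum: "cauchy_coeff j = residue_sum 0 j 1"
  unfolding cauchy_coeff_def residue_sum_def sum_distrib_left
  using residue_eq_product by (intro sum.cong) auto

lemma shift_comb_cauchy_coeff:
  assumes "\<And>l. l \<in> {1..r} \<Longrightarrow> m l + j - int s \<ge> 0"
  shows "shift_comb (\<Prod>u<s. [:1, - step_ratio u:]) cauchy_coeff j = residue_sum s j (step_poly s)"
  using assms
proof (induction s arbitrary: j)
  case 0
  show ?case by (simp add: shift_comb_1 cauchy_coeff_eq_residue_sum)
next
  case (Suc s)
  have split: "(\<Prod>u<Suc s. [:1, - step_ratio u:]) = [:1, - step_ratio s:] * (\<Prod>u<s. [:1, - step_ratio u:])"
    by (simp add: mult.commute)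
  have "m l + j - int s \<ge> 0" "m l + (j - 1) - int s \<ge> 0" if "l \<in> {1..r}" for l
    using Suc.prems[OF that] by simp_all
  from Suc.IH[OF this(1)] Suc.IH[OF this(2)]
  have "shift_comb (\<Prod>u<Suc s. [:1, - step_ratio u:]) cauchy_coeff j
      = residue_sum s j (step_poly s) - step_ratio s * residue_sum s (j - 1) (step_poly s)"
    unfolding split shift_comb_linear_factor by simp
  also have "\<dots> = residue_sum (Suc s) j (step_poly (Suc s))"
    using Suc.prems by (subst residue_sum_step) force+
  finally show ?case .
qed

lemma prod_step_ratio:
  "(\<Prod>u<zero_order + degree_drop. [:1, - step_ratio u:])
    = qpoch_poly 1 q zero_order * qpoch_poly Warg q degree_drop"
proof -
  have "(\<Prod>u<zero_order + degree_drop. [:1, - step_ratio u:])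
      = (\<Prod>u<zero_order. [:1, - step_ratio u:]) * (\<Prod>e<degree_drop. [:1, - step_ratio (zero_order + e):])"
    using prod.atLeastLessThan_concat[of 0 zero_order "zero_order + degree_drop" "\<lambda>u. [:1, - step_ratio u:]"]
      prod.shift_bounds_nat_ivl[of "\<lambda>u. [:1, - step_ratio u:]" 0 zero_order degree_drop]
    by (simp add: atLeast0LessThan add.commute)
  also have "(\<Prod>u<zero_order. [:1, - step_ratio u:]) = qpoch_poly 1 q zero_order"
    unfolding qpoch_poly_def by (intro prod.cong) (auto simp: step_ratio_def)
  also have "(\<Prod>e<degree_drop. [:1, - step_ratio (zero_order + e):])
      = (\<Prod>e<degree_drop. [:1, - (Warg * q ^ (degree_drop - Suc e)):])"
    by (intro prod.cong) (auto simp: step_ratio_def)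
  also have "\<dots> = qpoch_poly Warg q degree_drop"
    unfolding qpoch_poly_def by (rule prod.nat_diff_reindex)
  finally show ?thesis .
qed

text \<open>Under the assumption, the numerator of every function involved is a polynomial, down to the
one whose index is \<open>j\<close> minus the number of steps, and the two families of factors together achieve
the order at \<open>0\<close> and the degree that make the residue sum zero.\<close>

theorem cauchy_coeff_recurrence:
  assumes "\<And>l. l \<in> {1..r} \<Longrightarrow> m l + j - int (zero_order + degree_drop) \<ge> 0"
  shows "shift_comb (qpoch_poly 1 q zero_order * qpoch_poly Warg q degree_drop) cauchy_coeff j = 0"
proof -
  have "residue_sum (zero_order + degree_drop) j (step_poly (zero_order + degree_drop)) = 0"
  proof (rule residue_sum_vanishes[OF assms])
    have low: "[:0, 1:] ^ zero_order dvd step_poly (zero_order + degree_drop)"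
      "degree (step_poly (zero_order + degree_drop)) + degree_drop \<le> r * (zero_order + degree_drop)"
      using step_poly_lowering[of degree_drop] by auto
    show "[:0, 1:] ^ nat t dvd step_poly (zero_order + degree_drop)"
      using low(1) unfolding zero_order_def .
    have "index_sum - int r - t + 2 \<le> int degree_drop" by (simp add: degree_drop_def)
    with low(2) show "int (degree (step_poly (zero_order + degree_drop))) + (index_sum - int r - t + 2)
        \<le> int (r * (zero_order + degree_drop))" by linarith
  qed
  then show ?thesis
    unfolding prod_step_ratio[symmetric] using shift_comb_cauchy_coeff assms by simp
qed

end

section \<open>Reversal of the terminating series\<close>

lemma prod_list_idx: "(\<Prod>x\<leftarrow>idx r. f x) = (\<Prod>l=1..r. f l)"
  by (metis atLeastLessThanSuc_atLeastAtMost distinct_upt prod.distinct_set_conv_list set_upt)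

lemma set_idx_except: "set (idx_except r i) = {1..r} - {i}"
  by auto

lemma prod_list_idx_except: "(\<Prod>x\<leftarrow>idx_except r i. f x) = (\<Prod>l\<in>{1..r} - {i}. f l)"
  by (metis distinct_filter distinct_upt prod.distinct_set_conv_list set_idx_except)

lemma length_idx_except: "i \<in> {1..r} \<Longrightarrow> length (idx_except r i) = r - 1"
  by (metis card_Diff_singleton card_atLeastAtMost diff_Suc_1 distinct_card distinct_filter distinct_upt set_idx_except)

lemma qpoch_nonzero_le:
  assumes "qpoch a q N \<noteq> 0" and "int k \<le> N"
  shows "qpoch a q (int k) \<noteq> 0"
proof -
  obtain M where M: "N = int M" using assms(2) by (metis nonneg_int_cases of_nat_0_le_iff order.trans)
  from assms show ?thesis unfolding M qpoch_nat by auto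
qed

text \<open>The reason for termination of a series with upper parameter \<open>q^(-K)\<close>.\<close>

lemma qpoch_power_zero:
  assumes "q \<noteq> 0" and "k > K"
  shows "qpoch (q powi (- int K)) q (int k) = 0"
proof -
  have "1 - q powi (- int K) * q ^ K = 0" using assms(1) by (simp add: power_int_minus)
  with assms(2) show ?thesis unfolding qpoch_nat by (intro prod_zero) auto
qed

lemma prod_regroup:
  fixes c :: "'a::comm_semiring_1"
  shows "(\<Prod>l\<in>S. f l ^ k * c * (g l * h l)) = (\<Prod>l\<in>S. f l) ^ k * c ^ card S * ((\<Prod>l\<in>S. g l) * (\<Prod>l\<in>S. h l))"
  by (simp add: prod.distrib prod_power_distrib)

context residue_data
begin

lemma q_power_neq_1: "e \<noteq> 0 \<Longrightarrow> q powi e \<noteq> 1"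
proof
  assume e: "e \<noteq> 0" "q powi e = 1"
  have "q powi int (nat \<bar>e\<bar>) = 1"
    using e by (cases "e \<ge> 0") (auto simp: power_int_minus simp del: power_int_of_nat)
  then have "norm q ^ nat \<bar>e\<bar> = 1" by (metis norm_one norm_power power_int_of_nat)
  moreover have "nat \<bar>e\<bar> > 0" using e by simp
  ultimately show False using q_lt_1 power_less_one_iff[of "norm q" "nat \<bar>e\<bar>"] by simp
qed

lemma prod_q_powi:
  assumes "finite S"
  shows "(\<Prod>l\<in>S. q powi f l) = q powi (\<Sum>l\<in>S. f l)"
  using assms q_nonzero by (induction S rule: finite_induct) (auto simp: power_int_add)

text \<open>Here the last \<open>k\<close> factors of the shifted factorials in front of the series are split off and
read backwards. They cancel all parameters of the series that depend on \<open>j\<close>, and the powers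
collected on the way change the argument of the series into \<open>W\<close>.\<close>

lemma reversed_term:
  assumes i: "i \<in> {1..r}" and k: "int k \<le> j + n i"
    and lower: "\<And>l. l \<in> {1..r} \<Longrightarrow> qpoch (B l / A i * q powi (- m l - j)) q (j + n i) \<noteq> 0"
  shows "(\<Prod>l=1..r. qpoch (q * A i / B l) q (m l + j))
      / (qpoch q q (j + n i) * (\<Prod>l\<in>{1..r} - {i}. qpoch (A i / A l) q (n l + j + 1)))
      * ((qpoch (q powi (- j - n i)) q (int k) * (\<Prod>l=1..r. qpoch (B l / A i) q (int k))
            * (\<Prod>l\<in>{1..r} - {i}. qpoch (A l / A i * q powi (- n l - j)) q (int k)))
         / ((\<Prod>l=1..r. qpoch (B l / A i * q powi (- m l - j)) q (int k))
            * (\<Prod>l\<in>{1..r} - {i}. qpoch (q * A l / A i) q (int k)) * qpoch q q (int k))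
         * (q powi (- index_sum + int r - 1 + t)) ^ k)
    = phi_coeff i k * Warg ^ k * tail_coeff i (j - int k)"
proof -
  let ?e = "rev_factor q k"
  let ?R = "{1..r} - {i}"
  let ?z = "q powi (- index_sum + int r - 1 + t)"
  let ?y = "\<lambda>l. A i / B l * q powi (m l + j)"
  let ?u = "\<lambda>l. A i / A l * q powi (n l + j)"
  let ?b = "\<lambda>l. qpoch (B l / A i * q powi (- m l - j)) q (int k)"
  let ?d = "\<lambda>l. qpoch (A l / A i * q powi (- n l - j)) q (int k)"
  let ?own = "qpoch (q powi (- j - n i)) q (int k)"
  note nz = q_nonzero A_nonzero[OF i] rev_factor_nonzero[OF q_nonzero, of k]
  have cR: "card ?R = r - 1" using i by simp
  have num: "qpoch (q * A i / B l) q (m l + j)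
      = ?y l ^ k * ?e * (?b l * qpoch (q * A i / B l) q (m l + (j - int k)))" if l: "l \<in> {1..r}" for l
  proof -
    have "qpoch_defined (q * A i / B l) q (m l + j - int k)"
      using numer_defined_ge[OF i l, of "j - int k"] k by (simp add: algebra_simps)
    from qpoch_pull_top[OF q_nonzero _ this] nz B_nonzero[OF l]
    have "qpoch (q * A i / B l) q (m l + j) = qpoch (q * A i / B l) q (m l + j - int k)
        * ((q * A i / B l * q powi (m l + j - 1)) ^ k * ?e
           * qpoch (q powi (1 - (m l + j)) / (q * A i / B l)) q (int k))" by simp
    also have "q * A i / B l * q powi (m l + j - 1) = ?y l"
      using nz by (simp add: power_int_diff)
    also have "q powi (1 - (m l + j)) / (q * A i / B l) = B l / A i * q powi (- m l - j)"
      using nz by (simp add: power_int_diff power_int_add power_int_minus field_simps)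
    also have "m l + j - int k = m l + (j - int k)" by simp
    finally show ?thesis by (simp add: mult_ac)
  qed
  have den: "qpoch (A i / A l) q (n l + j + 1)
      = ?u l ^ k * ?e * (?d l * qpoch (A i / A l) q (n l + (j - int k) + 1))" if l: "l \<in> ?R" for l
  proof -
    have "qpoch_defined (A i / A l) q (n l + j + 1 - int k)"
      using A_generic[OF i, of l] l by (intro qpoch_defined_generic) auto
    from qpoch_pull_top[OF q_nonzero _ this] nz A_nonzero[of l] l
    have "qpoch (A i / A l) q (n l + j + 1) = qpoch (A i / A l) q (n l + j + 1 - int k)
        * ((A i / A l * q powi (n l + j)) ^ k * ?e
           * qpoch (q powi (1 - (n l + j + 1)) / (A i / A l)) q (int k))" by simp
    also have "q powi (1 - (n l + j + 1)) / (A i / A l) = A l / A i * q powi (- n l - j)"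
      using nz by (simp add: power_int_diff power_int_add power_int_minus field_simps)
    also have "n l + j + 1 - int k = n l + (j - int k) + 1" by simp
    finally show ?thesis by (simp add: mult_ac)
  qed
  have own: "qpoch q q (j + n i) = (q powi (j + n i)) ^ k * ?e * (?own * qpoch q q (j + n i - int k))"
  proof -
    have "qpoch_defined q q (j + n i - int k)" using k by (simp add: qpoch_defined_def)
    from qpoch_pull_top[OF q_nonzero q_nonzero this]
    have "qpoch q q (j + n i) = qpoch q q (j + n i - int k)
        * ((q * q powi (j + n i - 1)) ^ k * ?e * qpoch (q powi (1 - (j + n i)) / q) q (int k))" .
    also have "q * q powi (j + n i - 1) = q powi (j + n i)"
      using q_nonzero by (simp add: power_int_diff)
    also have "q powi (1 - (j + n i)) / q = q powi (- j - n i)"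
      using q_nonzero by (simp add: power_int_diff power_int_add power_int_minus field_simps)
    finally show ?thesis by (simp only: mult_ac)
  qed
  have b_nz: "(\<Prod>l=1..r. ?b l) \<noteq> 0"
    using qpoch_nonzero_le[OF lower k] by simp
  have d_nz: "(\<Prod>l\<in>?R. ?d l) \<noteq> 0"
  proof -
    have "?d l \<noteq> 0" if l: "l \<in> ?R" for l
    proof (rule qpoch_nonzero)
      fix e
      have "A l / A i * q powi (- n l - j + e) \<noteq> 1" using A_generic[of l i] l i by auto
      then show "A l / A i * q powi (- n l - j) * q powi e \<noteq> 1"
        using q_nonzero by (simp add: power_int_add mult.assoc)
    qed
    then show ?thesis by simp
  qed
  have own_nz: "?own \<noteq> 0"
  proof -
    have "q powi (- j - n i) * q ^ u \<noteq> 1" if "u < k" for u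
      using q_power_neq_1[of "- j - n i + int u"] that k q_nonzero by (simp add: power_int_add)
    then show ?thesis unfolding qpoch_nat by simp
  qed
  define Nt where "Nt = (\<Prod>l=1..r. qpoch (q * A i / B l) q (m l + (j - int k)))"
  define Dt where "Dt = (\<Prod>l\<in>?R. qpoch (A i / A l) q (n l + (j - int k) + 1))"
  have N: "(\<Prod>l=1..r. qpoch (q * A i / B l) q (m l + j))
      = (\<Prod>l=1..r. ?y l) ^ k * ?e ^ r * ((\<Prod>l=1..r. ?b l) * Nt)"
    by (subst prod.cong[OF refl num], assumption) (simp only: prod_regroup Nt_def card_atLeastAtMost diff_Suc_1)
  have D: "(\<Prod>l\<in>?R. qpoch (A i / A l) q (n l + j + 1))
      = (\<Prod>l\<in>?R. ?u l) ^ k * ?e ^ (r - 1) * ((\<Prod>l\<in>?R. ?d l) * Dt)"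
    by (subst prod.cong[OF refl den], assumption) (simp only: prod_regroup Dt_def cR)
  have ee: "?e ^ r = ?e * ?e ^ (r - 1)" using r_pos by (simp flip: power_Suc)
  have "(\<Prod>l=1..r. ?y l) * ?z = Warg * (q powi (j + n i) * (\<Prod>l\<in>?R. ?u l))"
  proof -
    have "(\<Prod>l=1..r. ?y l) = A_over_B * (\<Prod>l=1..r. A i / A l * q powi (m l + j))"
      unfolding A_over_B_def prod.distrib[symmetric] using A_nonzero by (intro prod.cong) auto
    also have "\<dots> = A_over_B * ((\<Prod>l=1..r. A i / A l) * q powi (\<Sum>l=1..r. m l + j))"
      by (simp only: prod.distrib prod_q_powi finite_atLeastAtMost)
    also have "(\<Prod>l=1..r. A i / A l) = (\<Prod>l\<in>?R. A i / A l)"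
      using i nz by (subst prod.remove[of _ i]) auto
    finally have y: "(\<Prod>l=1..r. ?y l) = A_over_B * ((\<Prod>l\<in>?R. A i / A l) * q powi (\<Sum>l=1..r. m l + j))" .
    have "q powi (j + n i) * (\<Prod>l\<in>?R. ?u l)
        = (\<Prod>l\<in>?R. A i / A l) * (q powi (n i + j) * q powi (\<Sum>l\<in>?R. n l + j))"
      by (simp only: prod.distrib prod_q_powi finite_Diff finite_atLeastAtMost add.commute[of j "n i"] mult.left_commute)
    also have "q powi (n i + j) * q powi (\<Sum>l\<in>?R. n l + j) = q powi (\<Sum>l=1..r. n l + j)"
      using i q_nonzero by (subst (2) sum.remove[of _ i]) (auto simp: power_int_add)
    finally have u: "q powi (j + n i) * (\<Prod>l\<in>?R. ?u l)
        = (\<Prod>l\<in>?R. A i / A l) * q powi (\<Sum>l=1..r. n l + j)" .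
    have "q powi (\<Sum>l=1..r. m l + j) * ?z = q powi (t + int r - 1) * q powi (\<Sum>l=1..r. n l + j)"
      using q_nonzero by (simp add: index_sum_def sum.distrib algebra_simps flip: power_int_add)
    note powers = this
    have "b * (x * c) * z = d * b * (x * e)" if "c * z = d * e" for b c d e x z :: complex
    proof -
      have "b * (x * c) * z = (c * z) * (b * x)" by (simp add: mult_ac)
      also have "\<dots> = d * b * (x * e)" unfolding that by (simp add: mult_ac)
      finally show ?thesis .
    qed
    from this[OF powers] show ?thesis unfolding y u Warg_def .
  qed
  then have W: "(\<Prod>l=1..r. ?y l) ^ k * ?z ^ k = Warg ^ k * ((q powi (j + n i)) ^ k * (\<Prod>l\<in>?R. ?u l) ^ k)"
    by (simp only: power_mult_distrib[symmetric])
  have u_nz: "(q powi (j + n i)) ^ k * (\<Prod>l\<in>?R. ?u l) ^ k \<noteq> 0"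
    using nz A_nonzero by auto
  have cancel: "Y * (e * e') * (bb * Nt') / (Q * e * (ow * qn) * (U * e' * (dd * Dt'))) * (ow * pn * dd / (bb * pd * pq) * z)
      = pn / (pq * pd) * w * (Nt' / (qn * Dt'))"
    if "Y * z = w * (Q * U)" "e \<noteq> 0" "e' \<noteq> 0" "bb \<noteq> 0" "dd \<noteq> 0" "ow \<noteq> 0" "Q * U \<noteq> 0"
    for Y e e' bb Nt' Q ow qn U dd Dt' pn pd pq z w :: complex
  proof -
    have "Y * (e * e') * (bb * Nt') / (Q * e * (ow * qn) * (U * e' * (dd * Dt'))) * (ow * pn * dd / (bb * pd * pq) * z)
        = (Y * z) * ((e * e' * bb * ow * dd) * (Nt' * pn)) / ((Q * U) * ((e * e' * bb * ow * dd) * (qn * Dt' * pd * pq)))"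
      by (simp add: mult_ac)
    also have "\<dots> = w * ((Nt' * pn) / (qn * Dt' * pd * pq))"
      unfolding that(1) using that by simp
    finally show ?thesis by (simp add: mult_ac)
  qed
  have e: "j - int k + n i = j + n i - int k" by simp
  have "?e ^ (r - 1) \<noteq> 0" using nz(3) by simp
  show ?thesis
    unfolding N D own ee phi_coeff_def tail_coeff_def Nt_def[symmetric] Dt_def[symmetric] e
    by (rule cancel[OF W nz(3) \<open>?e ^ (r - 1) \<noteq> 0\<close> b_nz d_nz own_nz u_nz])
qed

lemma reversed_series:
  assumes i: "i \<in> {1..r}" and K: "j + n i \<ge> 0"
    and lower: "\<And>l. l \<in> {1..r} \<Longrightarrow> qpoch (B l / A i * q powi (- m l - j)) q (j + n i) \<noteq> 0"
  shows "(\<Prod>l=1..r. qpoch (q * A i / B l) q (m l + j))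
      / (qpoch q q (j + n i) * (\<Prod>l\<in>{1..r} - {i}. qpoch (A i / A l) q (n l + j + 1)))
      * qhyp q
          ([q powi (- j - n i)] @ map (\<lambda>l. B l / A i) (idx r)
             @ map (\<lambda>l. A l / A i * q powi (- n l - j)) (idx_except r i))
          (map (\<lambda>l. B l / A i * q powi (- m l - j)) (idx r) @ map (\<lambda>l. q * A l / A i) (idx_except r i))
          (q powi (- index_sum + int r - 1 + t))
    = (\<Sum>k<poles j i. phi_coeff i k * Warg ^ k * tail_coeff i (j - int k))"
proof -
  let ?R = "{1..r} - {i}"
  let ?cs = "[q powi (- j - n i)] @ map (\<lambda>l. B l / A i) (idx r)
             @ map (\<lambda>l. A l / A i * q powi (- n l - j)) (idx_except r i)"
  let ?ds = "map (\<lambda>l. B l / A i * q powi (- m l - j)) (idx r) @ map (\<lambda>l. q * A l / A i) (idx_except r i)"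
  let ?z = "q powi (- index_sum + int r - 1 + t)"
  define F where "F k = (qpoch (q powi (- j - n i)) q (int k) * (\<Prod>l=1..r. qpoch (B l / A i) q (int k))
            * (\<Prod>l\<in>?R. qpoch (A l / A i * q powi (- n l - j)) q (int k)))
         / ((\<Prod>l=1..r. qpoch (B l / A i * q powi (- m l - j)) q (int k))
            * (\<Prod>l\<in>?R. qpoch (q * A l / A i) q (int k)) * qpoch q q (int k))
         * ?z ^ k" for k
  have len: "1 + length ?ds - length ?cs = 0"
    using length_idx_except[OF i] by simp
  have "qhyp q ?cs ?ds ?z = (\<Sum>k. F k)"
    unfolding qhyp_def len F_def
    by (simp only: map_append list.map prod_list.append prod_list.Cons prod_list.Nil map_map o_def
        prod_list_idx prod_list_idx_except power_0 mult_1_right mult.assoc)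
  also have "\<dots> = (\<Sum>k<poles j i. F k)"
  proof (rule suminf_finite)
    fix k assume "k \<notin> {..<poles j i}"
    then have "k > nat (j + n i)" and "- j - n i = - int (nat (j + n i))"
      using K by (auto simp: poles_def)
    then have "qpoch (q powi (- j - n i)) q (int k) = 0"
      using qpoch_power_zero[OF q_nonzero] by metis
    then show "F k = 0" by (simp add: F_def)
  qed simp
  finally have series: "qhyp q ?cs ?ds ?z = (\<Sum>k<poles j i. F k)" .
  show ?thesis
    unfolding series sum_distrib_left F_def
    by (intro sum.cong refl reversed_term[OF i _ lower]) (auto simp: poles_def)
qed

end

section \<open>Passage to the limit\<close>

text \<open>Tannery's theorem, with the summable majorant \<open>C \<bar>x\<^sub>k\<bar>\<close> for a bound \<open>C\<close> of \<open>e\<close>.\<close>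

lemma convolution_LIMSEQ:
  fixes x e :: "nat \<Rightarrow> complex"
  assumes "summable (\<lambda>k. norm (x k))" and "e \<longlonglongrightarrow> l"
  shows "(\<lambda>N. \<Sum>k\<le>N. x k * e (N - k)) \<longlonglongrightarrow> (\<Sum>k. x k) * l"
proof -
  obtain C where C: "\<And>s. norm (e s) \<le> C"
    using convergent_imp_Bseq[OF convergentI[OF assms(2)]] unfolding Bseq_def by blast
  define a where "a k N = (if k \<le> N then x k * e (N - k) else 0)" for k N
  have lim: "(\<lambda>N. a k N) \<longlonglongrightarrow> x k * l" for k
  proof -
    have "(\<lambda>N. x k * e (N - k)) \<longlonglongrightarrow> x k * l"
      using assms(2) by (intro tendsto_mult_left) (rule LIMSEQ_offset[where k = k], simp)
    moreover have "\<forall>\<^sub>F N in sequentially. x k * e (N - k) = a k N"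
      unfolding eventually_sequentially a_def by auto
    ultimately show ?thesis by (rule Lim_transform_eventually)
  qed
  have C0: "C \<ge> 0" using C[of 0] norm_ge_zero order.trans by blast
  have bound: "norm (a k N) \<le> norm (x k) * C" for k N
    unfolding a_def using C[of "N - k"] C0 by (auto simp: norm_mult mult_left_mono)
  have sums: "suminf (\<lambda>k. a k N) = (\<Sum>k\<le>N. x k * e (N - k))" for N
  proof -
    have "suminf (\<lambda>k. a k N) = (\<Sum>k\<le>N. a k N)" by (rule suminf_finite) (auto simp: a_def)
    then show ?thesis by (simp add: a_def)
  qed
  have "summable (\<lambda>k. norm (x k) * C)" using assms(1) by (rule summable_mult2)
  moreover have "\<forall>\<^sub>F (k, N) in sequentially \<times>\<^sub>F sequentially. norm (a k N) \<le> norm (x k) * C"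
    using bound by (intro always_eventually) auto
  ultimately have "(\<lambda>N. suminf (\<lambda>k. a k N)) \<longlonglongrightarrow> suminf (\<lambda>k. x k * l)"
    using tannerys_theorem[where a = a and M = "\<lambda>k. norm (x k) * C", OF lim] sequentially_bot by blast
  moreover have "suminf (\<lambda>k. x k * l) = (\<Sum>k. x k) * l"
    by (rule suminf_mult2[symmetric]) (rule summable_norm_cancel[OF assms(1)])
  ultimately show ?thesis unfolding sums by simp
qed

text \<open>The factor \<open>1 - z\<close> makes the sum telescope to a value of \<open>shift_comb C f\<close> that is the same for
all large upper bounds, hence equal to the limit.\<close>

lemma sum_shift_comb_eq_limit:
  assumes zero: "\<And>j. j < s \<Longrightarrow> f j = 0"
    and lim: "(\<lambda>k. f (int k)) \<longlonglongrightarrow> l"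
    and rec: "\<And>k. k > K \<Longrightarrow> shift_comb ([:1, - 1:] * C) f k = 0"
  shows "(\<Sum>k\<in>{s..K}. shift_comb ([:1, - 1:] * C) f k) = poly C 1 * l"
proof -
  let ?S = "\<Sum>k\<in>{s..K}. shift_comb ([:1, - 1:] * C) f k"
  have low: "shift_comb C f (s - 1) = 0"
    unfolding shift_comb_def by (intro sum.neutral) (auto intro: zero)
  define D where "D = shift_comb ([:1, - 1:] * C) f"
  have D: "D k = shift_comb C f k - shift_comb C f (k - 1)" for k
    unfolding D_def by (simp only: shift_comb_linear_factor mult_1_left)
  have tele: "(\<Sum>k\<in>{s..s - 1 + int N}. D k) = shift_comb C f (s - 1 + int N)" for N
  proof (induction N)
    case (Suc N)
    have "{s..s - 1 + int (Suc N)} = insert (s + int N) {s..s - 1 + int N}" by auto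
    moreover have "s + int N - 1 = s - 1 + int N" by simp
    then have "D (s + int N) = shift_comb C f (s + int N) - shift_comb C f (s - 1 + int N)"
      using D[of "s + int N"] by (simp only:)
    moreover have "s - 1 + int (Suc N) = s + int N" by simp
    ultimately show ?case using Suc by simp
  qed (simp add: low)
  have "shift_comb C f (s - 1 + int N) = ?S" if "N \<ge> nat (K - s + 1)" for N
  proof -
    have "(\<Sum>k\<in>{s..s - 1 + int N}. D k) = ?S"
      using that rec unfolding D_def by (intro sum.mono_neutral_right) auto
    then show ?thesis using tele by simp
  qed
  then have "\<forall>\<^sub>F N in sequentially. ?S = shift_comb C f (s - 1 + int N)"
    unfolding eventually_sequentially by metis
  then have "(\<lambda>N. shift_comb C f (s - 1 + int N)) \<longlonglongrightarrow> ?S"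
    by (rule Lim_transform_eventually[OF tendsto_const])
  moreover have "(\<lambda>N. shift_comb C f (s - 1 + int N)) \<longlonglongrightarrow> poly C 1 * l"
    by (rule LIMSEQ_int_offset[OF shift_comb_LIMSEQ[OF lim]])
  ultimately show ?thesis by (rule LIMSEQ_unique)
qed

lemma shift_comb_limit_zero:
  assumes "(\<lambda>k. f (int k)) \<longlonglongrightarrow> l" and "\<And>k. k > K \<Longrightarrow> shift_comb C f k = 0"
  shows "poly C 1 * l = 0"
proof -
  have "(\<lambda>k. shift_comb C f (K + 1 + int k)) \<longlonglongrightarrow> poly C 1 * l"
    by (rule LIMSEQ_int_offset[OF shift_comb_LIMSEQ[OF assms(1)]])
  moreover have "shift_comb C f (K + 1 + int k) = 0" for k by (rule assms(2)) simp
  ultimately show ?thesis by (simp add: LIMSEQ_const_iff)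
qed

lemma qpoch_poly_peel: "qpoch_poly w q (Suc N) = [:1, - w:] * qpoch_poly (w * q) q N"
  unfolding qpoch_poly_def by (simp add: prod.lessThan_Suc_shift mult.assoc del: prod.lessThan_Suc)

text \<open>The inner sum in the definition of \<open>\<beta>\<^sub>k\<close> is, up to sign, a coefficient of the product of two
polynomials given by the q-binomial theorem.\<close>

lemma coeff_qpoch_poly_mult:
  assumes "q \<noteq> 0" and "norm q < 1" and "i \<ge> 0"
  shows "coeff (qpoch_poly 1 q G * qpoch_poly w q H) (nat i)
    = (- 1) ^ nat i * (\<Sum>(g, h)\<in>{(g :: nat, h :: nat). int g + int h = i}.
        qbinom q (int H) (int h) * qbinom q (int G) (int g)
        * q ^ ((h * (h - 1) + g * (g - 1)) div 2) * w ^ h)"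
proof -
  have tri: "(h * (h - 1) + g * (g - 1)) div 2 = g * (g - 1) div 2 + h * (h - 1) div 2" for g h :: nat
  proof -
    have "even (h * (h - 1))" "even (g * (g - 1))" by (cases h; simp) (cases g; simp)
    then show ?thesis by (simp add: add.commute)
  qed
  have set: "{(g :: nat, h :: nat). int g + int h = i} = (\<lambda>g. (g, nat i - g)) ` {..nat i}"
    using assms(3) by (auto simp: image_iff)
  have "coeff (qpoch_poly 1 q G * qpoch_poly w q H) (nat i)
      = (\<Sum>g\<le>nat i. (- 1) ^ nat i * (qbinom q (int H) (int (nat i - g)) * qbinom q (int G) (int g)
        * q ^ (((nat i - g) * ((nat i - g) - 1) + g * (g - 1)) div 2) * w ^ (nat i - g)))"
    unfolding coeff_mult coeff_qpoch_poly[OF assms(1,2)] tri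
  proof (rule sum.cong)
    fix g assume "g \<in> {..nat i}"
    then have "(- 1) ^ nat i = (- 1) ^ g * ((- 1) ^ (nat i - g) :: complex)" by (simp flip: power_add)
    then show "(- 1) ^ g * qbinom q (int G) (int g) * q ^ (g * (g - 1) div 2) * 1 ^ g
        * ((- 1) ^ (nat i - g) * qbinom q (int H) (int (nat i - g))
           * q ^ ((nat i - g) * (nat i - g - 1) div 2) * w ^ (nat i - g))
      = (- 1) ^ nat i * (qbinom q (int H) (int (nat i - g)) * qbinom q (int G) (int g)
        * q ^ (g * (g - 1) div 2 + (nat i - g) * (nat i - g - 1) div 2) * w ^ (nat i - g))"
      by (simp add: power_add mult_ac)
  qed simp
  also have "\<dots> = (- 1) ^ nat i * (\<Sum>(g, h)\<in>{(g :: nat, h :: nat). int g + int h = i}.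
        qbinom q (int H) (int h) * qbinom q (int G) (int g)
        * q ^ ((h * (h - 1) + g * (g - 1)) div 2) * w ^ h)"
    unfolding set by (subst sum.reindex) (auto simp: inj_on_def sum_distrib_left)
  finally show ?thesis .
qed

context residue_data
begin

definition tail_limit :: "nat \<Rightarrow> complex" where
  "tail_limit i = (\<Prod>l=1..r. qpoch_inf (q * A i / B l) q)
     / (qpoch_inf q q * (\<Prod>l\<in>{1..r} - {i}. qpoch_inf (A i / A l) q))"

lemma qpoch_inf_self_nonzero: "qpoch_inf q q \<noteq> 0"
proof (rule qpoch_inf_nonzeroI[OF q_lt_1])
  fix k
  have "q powi int (Suc k) \<noteq> 1" by (rule q_power_neq_1) simp
  then show "q * q ^ k \<noteq> 1" unfolding power_int_of_nat power_Suc .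
qed

lemma qpoch_inf_A_nonzero:
  assumes "i \<in> {1..r}" and "l \<in> {1..r} - {i}"
  shows "qpoch_inf (A i / A l) q \<noteq> 0"
proof (rule qpoch_inf_nonzeroI[OF q_lt_1])
  fix k show "A i / A l * q ^ k \<noteq> 1" using A_generic[of i l "int k"] assms by auto
qed

lemma tail_coeff_LIMSEQ:
  assumes i: "i \<in> {1..r}"
  shows "(\<lambda>s. tail_coeff i (c + int s)) \<longlonglongrightarrow> tail_limit i"
proof -
  have off: "(\<lambda>s. qpoch a q (d + int s)) \<longlonglongrightarrow> qpoch_inf a q" for a d
    by (rule LIMSEQ_int_offset[OF qpoch_LIMSEQ[OF q_lt_1]])
  have "(\<lambda>s. qpoch a q (d + (c + int s))) \<longlonglongrightarrow> qpoch_inf a q" for a d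
    using off[of a "d + c"] by (simp add: add.assoc)
  moreover have "(\<lambda>s. qpoch a q (c + int s + d)) \<longlonglongrightarrow> qpoch_inf a q" for a d
    using off[of a "d + c"] by (simp add: algebra_simps)
  moreover have "(\<lambda>s. qpoch a q (d + (c + int s) + 1)) \<longlonglongrightarrow> qpoch_inf a q" for a d
    using off[of a "d + c + 1"] by (simp add: algebra_simps)
  ultimately show ?thesis
    unfolding tail_coeff_def tail_limit_def
    using qpoch_inf_self_nonzero qpoch_inf_A_nonzero[OF i]
    by (intro tendsto_divide tendsto_mult tendsto_prod) auto
qed

lemma summable_phi:
  assumes i: "i \<in> {1..r}" and W: "norm Warg < 1"
  shows "summable (\<lambda>k. norm (phi_coeff i k * Warg ^ k))"
proof -
  have nz: "qpoch_inf (q * A l / A i) q \<noteq> 0" if "l \<in> {1..r} - {i}" for l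
  proof (rule qpoch_inf_nonzeroI[OF q_lt_1])
    fix k
    have "A l / A i * q powi (int (Suc k)) \<noteq> 1" using A_generic[of l i] i that by auto
    moreover have "A l / A i * q powi (int (Suc k)) = q * A l / A i * q ^ k"
      unfolding power_int_of_nat by simp
    ultimately show "q * A l / A i * q ^ k \<noteq> 1" by metis
  qed
  have "(\<lambda>k. phi_coeff i k) \<longlonglongrightarrow> (\<Prod>l=1..r. qpoch_inf (B l / A i) q)
     / (qpoch_inf q q * (\<Prod>l\<in>{1..r} - {i}. qpoch_inf (q * A l / A i) q))"
    unfolding phi_coeff_def
    using qpoch_inf_self_nonzero nz
    by (intro tendsto_divide tendsto_mult tendsto_prod qpoch_LIMSEQ[OF q_lt_1]) auto
  then have "Bseq (\<lambda>k. phi_coeff i k)" by (intro convergent_imp_Bseq convergentI)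
  then obtain C where C: "\<And>k. norm (phi_coeff i k) \<le> C" unfolding Bseq_def by blast
  have "summable (\<lambda>k. C * norm Warg ^ k)" using W by (intro summable_mult summable_geometric) simp
  then show ?thesis
    by (rule summable_comparison_test') (auto simp: norm_mult norm_power intro!: mult_right_mono C)
qed

text \<open>Each summand is a convolution of an absolutely summable sequence with a convergent one.\<close>

lemma cauchy_coeff_LIMSEQ:
  assumes W: "norm Warg < 1"
  shows "(\<lambda>j. cauchy_coeff (int j))
    \<longlonglongrightarrow> (\<Sum>i=1..r. A i powi (1 - t) * ((\<Sum>k. phi_coeff i k * Warg ^ k) * tail_limit i))"
  unfolding cauchy_coeff_def
proof (intro tendsto_sum tendsto_mult_left)
  fix i assume i: "i \<in> {1..r}"
  let ?f = "\<lambda>j. \<Sum>k<poles j i. phi_coeff i k * Warg ^ k * tail_coeff i (j - int k)"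
  have "(\<lambda>N. \<Sum>k\<le>N. phi_coeff i k * Warg ^ k * tail_coeff i (- n i + int (N - k)))
      \<longlonglongrightarrow> (\<Sum>k. phi_coeff i k * Warg ^ k) * tail_limit i"
    by (rule convolution_LIMSEQ[OF summable_phi[OF i W] tail_coeff_LIMSEQ[OF i]])
  moreover have "(\<Sum>k\<le>N. phi_coeff i k * Warg ^ k * tail_coeff i (- n i + int (N - k))) = ?f (- n i + int N)" for N
  proof (rule sum.cong)
    show "{..N} = {..<poles (- n i + int N) i}" by (auto simp: poles_def)
    fix k assume "k \<in> {..<poles (- n i + int N) i}"
    then have "- n i + int (N - k) = - n i + int N - int k" by (auto simp: poles_def of_nat_diff)
    then show "phi_coeff i k * Warg ^ k * tail_coeff i (- n i + int (N - k))
      = phi_coeff i k * Warg ^ k * tail_coeff i (- n i + int N - int k)" by (simp only:)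
  qed
  ultimately have "(\<lambda>N. ?f (- n i + int N)) \<longlonglongrightarrow> (\<Sum>k. phi_coeff i k * Warg ^ k) * tail_limit i" by simp
  from LIMSEQ_int_offset[of "\<lambda>j. ?f (- n i + j)", OF this, of "n i"]
  show "(\<lambda>j. ?f (int j)) \<longlonglongrightarrow> (\<Sum>k. phi_coeff i k * Warg ^ k) * tail_limit i" by simp
qed

lemma phi_sum_eq_qhyp:
  assumes i: "i \<in> {1..r}"
  shows "(\<Sum>k. phi_coeff i k * Warg ^ k)
    = qhyp q (map (\<lambda>l. B l / A i) (idx r)) (map (\<lambda>l. q * A l / A i) (idx_except r i)) Warg"
proof -
  have len: "1 + length (map (\<lambda>l. q * A l / A i) (idx_except r i)) - length (map (\<lambda>l. B l / A i) (idx r)) = 0"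
    using length_idx_except[OF i] r_pos by (simp only: length_map) simp
  show ?thesis
    unfolding qhyp_def len phi_coeff_def
    by (simp only: map_map o_def prod_list_idx prod_list_idx_except power_0 mult_1_right mult_1_left mult.commute)
qed

text \<open>The identity for \<open>\<alpha>\<close> in its convolution form. The bound \<open>s\<close> is any index below which all
convolutions are empty, and \<open>K\<close> any index beyond which the recurrence holds.\<close>

theorem weighted_sum_eq:
  assumes W: "norm Warg < 1"
    and low: "\<And>i j. i \<in> {1..r} \<Longrightarrow> j < s \<Longrightarrow> j + n i < 0"
    and high: "\<And>l. l \<in> {1..r} \<Longrightarrow> K + 1 + m l \<ge> int (zero_order + degree_drop)"
  shows "(\<Sum>i=1..r. A i powi (1 - t)
        * ((\<Prod>l=1..r. qpoch_inf (q * A i / B l) q) / (\<Prod>l\<in>{1..r} - {i}. qpoch_inf (A i / A l) q))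
        * qhyp q (map (\<lambda>l. B l / A i) (idx r)) (map (\<lambda>l. q * A l / A i) (idx_except r i)) Warg)
    = qpoch_inf (q powi t) q / qpoch Warg q (int degree_drop)
      * (\<Sum>k\<in>{s..K}. shift_comb (qpoch_poly 1 q zero_order * qpoch_poly Warg q degree_drop) cauchy_coeff k)"
proof -
  define limit where
    "limit = (\<Sum>i=1..r. A i powi (1 - t) * ((\<Sum>k. phi_coeff i k * Warg ^ k) * tail_limit i))"
  have lim: "(\<lambda>j. cauchy_coeff (int j)) \<longlonglongrightarrow> limit"
    unfolding limit_def by (rule cauchy_coeff_LIMSEQ[OF W])
  have "(\<Sum>i=1..r. A i powi (1 - t)
        * ((\<Prod>l=1..r. qpoch_inf (q * A i / B l) q) / (\<Prod>l\<in>{1..r} - {i}. qpoch_inf (A i / A l) q))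
        * qhyp q (map (\<lambda>l. B l / A i) (idx r)) (map (\<lambda>l. q * A l / A i) (idx_except r i)) Warg)
      = qpoch_inf q q * limit"
    unfolding limit_def sum_distrib_left
  proof (rule sum.cong)
    fix i assume i: "i \<in> {1..r}"
    show "A i powi (1 - t)
        * ((\<Prod>l=1..r. qpoch_inf (q * A i / B l) q) / (\<Prod>l\<in>{1..r} - {i}. qpoch_inf (A i / A l) q))
        * qhyp q (map (\<lambda>l. B l / A i) (idx r)) (map (\<lambda>l. q * A l / A i) (idx_except r i)) Warg
      = qpoch_inf q q * (A i powi (1 - t) * ((\<Sum>k. phi_coeff i k * Warg ^ k) * tail_limit i))"
      unfolding phi_sum_eq_qhyp[OF i] tail_limit_def using qpoch_inf_self_nonzero by simp
  qed simp
  note lhs = this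
  have zero: "cauchy_coeff j = 0" if "j < s" for j
    unfolding cauchy_coeff_def poles_def using low that by (intro sum.neutral) force
  have rec: "shift_comb (qpoch_poly 1 q zero_order * qpoch_poly Warg q degree_drop) cauchy_coeff k = 0"
    if "k > K" for k
    using high that by (intro cauchy_coeff_recurrence) force
  have Wnz: "qpoch Warg q (int degree_drop) \<noteq> 0"
  proof -
    have "Warg * q ^ k \<noteq> 1" for k
    proof
      assume "Warg * q ^ k = 1"
      then have "norm Warg * norm q ^ k = 1" by (metis norm_mult norm_one norm_power)
      moreover have "norm Warg * norm q ^ k \<le> norm Warg * 1"
        using q_lt_1 by (intro mult_left_mono power_le_one) auto
      ultimately show False using W by simp
    qed
    then show ?thesis unfolding qpoch_nat by simp
  qed
  show ?thesis
  proof (cases "t \<ge> 1")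
    case True
    define T where "T = zero_order - 1"
    have T: "zero_order = Suc T" and t: "t = int (Suc T)" using True by (auto simp: T_def zero_order_def)
    have split: "qpoch_poly 1 q zero_order * qpoch_poly Warg q degree_drop
        = [:1, - 1:] * (qpoch_poly q q T * qpoch_poly Warg q degree_drop)"
      unfolding T qpoch_poly_peel by (simp only: mult.assoc mult_1_left)
    have "(\<Sum>k\<in>{s..K}. shift_comb (qpoch_poly 1 q zero_order * qpoch_poly Warg q degree_drop) cauchy_coeff k)
        = qpoch q q (int T) * qpoch Warg q (int degree_drop) * limit"
      using sum_shift_comb_eq_limit[OF zero lim rec[unfolded split]] unfolding split
      by (simp add: poly_qpoch_poly)
    moreover have "qpoch_inf q q = qpoch q q (int T) * qpoch_inf (q powi t) q"
      using qpoch_inf_split[OF q_nonzero q_lt_1, of q T] unfolding t by (simp add: power_int_add)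
    ultimately show ?thesis unfolding lhs using Wnz by simp
  next
    case False
    have "qpoch_inf (q powi t) q = 0"
    proof (rule ccontr)
      assume "qpoch_inf (q powi t) q \<noteq> 0"
      from qpoch_inf_nonzeroD[OF q_lt_1 this, of "nat (- t)"] False q_nonzero
      show False by (simp flip: power_int_of_nat power_int_add)
    qed
    moreover have "limit = 0"
    proof -
      have "zero_order = 0" using False by (simp add: zero_order_def)
      then have "poly (qpoch_poly 1 q zero_order * qpoch_poly Warg q degree_drop) 1 = qpoch Warg q (int degree_drop)"
        by (simp add: poly_qpoch_poly)
      moreover have "poly (qpoch_poly 1 q zero_order * qpoch_poly Warg q degree_drop) 1 * limit = 0"
        by (rule shift_comb_limit_zero[OF lim rec])
      ultimately show ?thesis using Wnz by simp
    qed
    ultimately show ?thesis unfolding lhs by simp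
  qed
qed

end

section \<open>The identity\<close>

text \<open>The form in which \<open>\<beta>\<^sub>k\<close> is defined: a sum over \<open>j\<close> from which the indices below the support
of the sequence are removed.\<close>

lemma shift_comb_window:
  assumes deg: "degree C \<le> D" and zero: "\<And>j. j < s \<Longrightarrow> f j = 0"
  shows "shift_comb C f k = (\<Sum>j\<in>{max s (k - int D)..k}. coeff C (nat (k - j)) * f j)"
proof -
  have "shift_comb C f k = (\<Sum>i\<le>D. coeff C i * f (k - int i))" by (rule shift_comb_le[OF deg])
  also have "\<dots> = (\<Sum>j\<in>{k - int D..k}. coeff C (nat (k - j)) * f j)"
    by (rule sum.reindex_bij_witness[of _ "\<lambda>j. nat (k - j)" "\<lambda>i. k - int i"]) auto
  also have "\<dots> = (\<Sum>j\<in>{max s (k - int D)..k}. coeff C (nat (k - j)) * f j)"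
    by (rule sum.mono_neutral_right) (auto simp: zero)
  finally show ?thesis .
qed

lemma qpow_add: "qpow L (x + y) = qpow L x * qpow L y"
  by (simp add: qpow_def distrib_right exp_add)

lemma qpow_diff: "qpow L (x - y) = qpow L x / qpow L y"
  by (simp add: qpow_def left_diff_distrib exp_diff)

lemma qpow_of_int: "qpow L (of_int k) = exp L powi k"
  by (simp add: qpow_def exp_power_int)

lemma qpow_mult_of_int: "qpow L (x * of_int k) = qpow L x powi k"
  by (simp add: qpow_def exp_power_int mult_ac)

lemma qpow_nonzero: "qpow L x \<noteq> 0"
  by (simp add: qpow_def)

theorem proposition1:
  fixes r :: nat and q L :: complex and a b :: "nat \<Rightarrow> complex"
    and m n :: "nat \<Rightarrow> int" and t :: int
  assumes "r \<ge> 2"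
    and "0 < norm q" and "norm q < 1" and "exp L = q"
    and "\<And>i j. 1 \<le> i \<Longrightarrow> i < j \<Longrightarrow> j \<le> r \<Longrightarrow> a i - a j \<notin> \<int>"
    and "norm (W_arg q L r a b t) < 1"
    and "no_vanishing_denominators q L r a b m n t"
  shows
    "(\<Sum>i=1..r.
        qpow L (a i * (1 - of_int t))
        * ((\<Prod>l=1..r. qpoch_inf (qpow L (1 - b l + a i)) q)
           / (\<Prod>l\<in>{1..r} - {i}. qpoch_inf (qpow L (a i - a l)) q))
        * qhyp q
            (map (\<lambda>l. qpow L (b l - a i)) (idx r))
            (map (\<lambda>l. qpow L (1 + a l - a i)) (idx_except r i))
            (W_arg q L r a b t))
     = qpoch_inf (q powi t) q / qpoch (W_arg q L r a b t) q (p_ind r m n t + 1)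
       * (\<Sum>k\<in>{- max_ind r n..p_ind r m n t + pos_part t - min_ind r m}.
            beta q L r a b m n t k)"
proof -
  define A where "A i = qpow L (a i)" for i
  define B where "B i = qpow L (b i)" for i
  have q0: "q \<noteq> 0" using assms(2) by auto
  have one: "qpow L 1 = q" using assms(4) by (simp add: qpow_def)
  have e1: "qpow L (b l - a i) = B l / A i" for i l by (simp add: qpow_diff A_def B_def)
  have e2: "qpow L (a l - a i - of_int (n l) - of_int j) = A l / A i * q powi (- n l - j)" for i l j
    using q0 by (simp add: qpow_diff qpow_of_int A_def assms(4) power_int_diff power_int_minus divide_inverse)
  have e3: "qpow L (b l - a i - of_int (m l) - of_int j) = B l / A i * q powi (- m l - j)" for i l j
    using q0 by (simp add: qpow_diff qpow_of_int A_def B_def assms(4) power_int_diff power_int_minus divide_inverse)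
  have e4: "qpow L (1 - a i + a l) = q * A l / A i" "qpow L (1 + a l - a i) = q * A l / A i" for i l
    by (simp_all add: qpow_diff qpow_add one A_def)
  have e5: "qpow L (1 - b l + a i) = q * A i / B l" for i l
    by (simp add: qpow_diff qpow_add one A_def B_def)
  have e6: "qpow L (a i - a l) = A i / A l" for i l by (simp add: qpow_diff A_def)
  have e7: "qpow L (a i * (1 - of_int t)) = A i powi (1 - t)" for i
    using qpow_mult_of_int[of L "a i" "1 - t"] by (simp add: A_def)
  note params = e1 e2 e3 e4 e5 e6 e7

  have n_max: "n i \<le> max_ind r n" if "i \<in> {1..r}" for i
    using that unfolding max_ind_def by (intro Max_ge) auto
  have m_min: "min_ind r m \<le> m l" if "l \<in> {1..r}" for l
    using that unfolding min_ind_def by (intro Min_le) auto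
  have inf_nz: "qpoch_inf (A i / A l) q \<noteq> 0" if "i \<in> {1..r}" "l \<in> {1..r} - {i}" for i l
    using assms(7) that unfolding no_vanishing_denominators_def e6 by blast
  have dd: "qpoch_defined (q * A i / B l) q (m l + j)"
      "qpoch (B l / A i * q powi (- m l - j)) q (j + n i) \<noteq> 0"
    if "j \<in> {- max_ind r n..top_ind r m n t}" "i \<in> {1..r}" "l \<in> {1..r}" "j + n i \<ge> 0" for i j l
    using assms(7) that unfolding no_vanishing_denominators_def e3 e5 by blast+

  interpret residue_data r q A B m n t
  proof
    show "q \<noteq> 0" "norm q < 1" "r \<ge> 1" using q0 assms by auto
    show "A i \<noteq> 0" "B i \<noteq> 0" for i by (simp_all add: A_def B_def qpow_nonzero)
    show "A i / A l * q powi k \<noteq> 1" if "i \<in> {1..r}" "l \<in> {1..r}" "i \<noteq> l" for i l k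
    proof (cases "k \<ge> 0")
      case True
      then show ?thesis
        using qpoch_inf_nonzeroD[OF assms(3) inf_nz[of i l], of "nat k"] that by (simp flip: power_int_of_nat)
    next
      case False
      then have "A l / A i * q powi (- k) \<noteq> 1"
        using qpoch_inf_nonzeroD[OF assms(3) inf_nz[of l i], of "nat (- k)"] that by (simp flip: power_int_of_nat)
      moreover have "A l / A i * q powi (- k) = inverse (A i / A l * q powi k)"
        by (simp add: power_int_minus divide_inverse mult_ac)
      ultimately show ?thesis by (metis inverse_1)
    qed
    show "qpoch_defined (q * A i / B l) q (m l - n i)" if il: "i \<in> {1..r}" "l \<in> {1..r}" for i l
    \<comment> \<open>If the index \<open>j = - n i\<close> occurs in the identity, then this symbol occurs there and is
      defined by assumption; otherwise its index \<open>m l - n i\<close> is nonnegative.\<close>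
    proof (cases "- n i \<le> top_ind r m n t")
      case True
      then show ?thesis using dd(1)[of "- n i" i l] n_max[OF il(1)] il by simp
    next
      case False
      then have "m l - n i \<ge> 0"
        using m_min[OF il(2)] by (simp add: top_ind_def p_ind_def pos_part_def)
      then show ?thesis by (simp add: qpoch_defined_def)
    qed
  qed

  have W: "W_arg q L r a b t = Warg"
    by (simp add: W_arg_def Warg_def A_over_B_def qpow_diff A_def B_def)
  have T: "int zero_order = pos_part t" by (simp add: zero_order_def pos_part_def)
  have P: "int degree_drop = p_ind r m n t + 1"
    by (simp add: degree_drop_def p_ind_def index_sum_def)
  have top: "p_ind r m n t + pos_part t - min_ind r m = top_ind r m n t"
    by (simp add: top_ind_def)
  let ?C = "qpoch_poly 1 q zero_order * qpoch_poly Warg q degree_drop"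
  have zero: "cauchy_coeff j = 0" if "j < - max_ind r n" for j
    unfolding cauchy_coeff_def poles_def
    by (intro sum.neutral ballI) (use n_max that in force)

  have alpha: "alpha q L r a b m n t j = cauchy_coeff j" if j: "j \<in> {- max_ind r n..top_ind r m n t}" for j
    unfolding alpha_def cauchy_coeff_def params
  proof (rule sum.cong)
    fix i assume i: "i \<in> {1..r}"
    have z: "(\<Sum>l=1..r. n l) - (\<Sum>l=1..r. m l) + int r - 1 + t = - index_sum + int r - 1 + t"
      by (simp add: index_sum_def)
    show "(if j + n i < 0 then 0
        else A i powi (1 - t) * (\<Prod>l=1..r. qpoch (q * A i / B l) q (m l + j))
             / (qpoch q q (j + n i) * (\<Prod>l\<in>{1..r} - {i}. qpoch (A i / A l) q (n l + j + 1)))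
             * qhyp q
                 ([q powi (- j - n i)] @ map (\<lambda>l. B l / A i) (idx r)
                  @ map (\<lambda>l. A l / A i * q powi (- n l - j)) (idx_except r i))
                 (map (\<lambda>l. B l / A i * q powi (- m l - j)) (idx r)
                  @ map (\<lambda>l. q * A l / A i) (idx_except r i))
                 (q powi ((\<Sum>l=1..r. n l) - (\<Sum>l=1..r. m l) + int r - 1 + t)))
      = A i powi (1 - t) * (\<Sum>k<poles j i. phi_coeff i k * Warg ^ k * tail_coeff i (j - int k))"
    proof (cases "j + n i < 0")
      case True
      then show ?thesis by (simp add: poles_def)
    next
      case False
      then have K: "j + n i \<ge> 0" by simp
      note series = reversed_series[OF i K dd(2)[OF j i _ K]]
      have "x * P / D * H = x * (P / D * H)" for x P D H :: complex by simp
      then show ?thesis unfolding z by (simp only: False if_False series)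
    qed
  qed simp

  have beta: "beta q L r a b m n t k = shift_comb ?C cauchy_coeff k" if k: "k \<in> {- max_ind r n..top_ind r m n t}" for k
  proof -
    have deg: "degree ?C \<le> zero_order + degree_drop"
      using degree_mult_le[of "qpoch_poly 1 q zero_order" "qpoch_poly Warg q degree_drop"]
        degree_qpoch_poly[of 1 q zero_order] degree_qpoch_poly[of Warg q degree_drop] by linarith
    have low: "k - p_ind r m n t - pos_part t - 1 = k - int (zero_order + degree_drop)"
      using T P by simp
    have window: "shift_comb ?C cauchy_coeff k
        = (\<Sum>j\<in>{max (- max_ind r n) (k - int (zero_order + degree_drop))..k}.
             coeff ?C (nat (k - j)) * cauchy_coeff j)"
      by (rule shift_comb_window[OF deg]) (rule zero)
    show ?thesis
      unfolding window beta_def low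
    proof (rule sum.cong)
      fix j assume "j \<in> {max (- max_ind r n) (k - int (zero_order + degree_drop))..k}"
      then have j: "j \<in> {- max_ind r n..top_ind r m n t}" and kj: "k - j \<ge> 0" using k by auto
      show "(-1) ^ nat (k - j) * alpha q L r a b m n t j
        * (\<Sum>(g, h)\<in>{(g :: nat, h :: nat). int g + int h = k - j}.
             qbinom q (p_ind r m n t + 1) (int h) * qbinom q (pos_part t) (int g)
             * q ^ ((h * (h - 1) + g * (g - 1)) div 2) * W_arg q L r a b t ^ h)
        = coeff ?C (nat (k - j)) * cauchy_coeff j"
        unfolding coeff_qpoch_poly_mult[OF q0 assms(3) kj] alpha[OF j] W T P by simp
    qed simp
  qed

  have betas: "(\<Sum>k\<in>{- max_ind r n..top_ind r m n t}. beta q L r a b m n t k)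
      = (\<Sum>k\<in>{- max_ind r n..top_ind r m n t}. shift_comb ?C cauchy_coeff k)"
    by (rule sum.cong[OF refl beta])
  show ?thesis
    unfolding params W top betas P[symmetric]
  proof (rule weighted_sum_eq)
    show "norm Warg < 1" using assms(6) unfolding W .
    show "j + n i < 0" if "i \<in> {1..r}" "j < - max_ind r n" for i j
      using n_max[OF that(1)] that(2) by simp
    show "top_ind r m n t + 1 + m l \<ge> int (zero_order + degree_drop)" if "l \<in> {1..r}" for l
      using m_min[OF that] T P by (simp add: top_ind_def)
  qed
qed

end
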